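(* Let $p>1$ be an integer, let $\gamma,\delta>\frac{p-1}{2}$, and let $U\sim J\beta E_p(\gamma,\delta)$. Denote by $V=U^{[p-1]}$ the upper left $(p-1)\times(p-1)$ subblock of the random matrix $U$. Then $$\Big(V,\ \frac{\det U}{\det V},\ \frac{\det(I_p-U)}{\det(I_{p-1}-V)}\Big)\ \stackrel{d}{=}\ J\beta E_{p-1}(\gamma,\delta)\otimes\big(p_{p-1,1},\ (1-p_{p-1,1})\,p_{p-1,2}\big),$$ where $p_{p-1,1}\sim\beta\big(\gamma-\tfrac{p-1}{2},\delta\big)$ and $p_{p-1,2}\sim\beta\big(\delta-\tfrac{p-1}{2},\tfrac{p-1}{2}\big)$ are independent beta-distributed random variables. That is, $V$ is independent of the pair $\big(\frac{\det U}{\det V},\frac{\det(I_p-U)}{\det(I_{p-1}-V)}\big)$, $V\sim J\beta E_{p-1}(\gamma,\delta)$, and the pair has the same distribution as $(p_{p-1,1},(1-p_{p-1,1})p_{p-1,2})$.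
   Context: $I_p$ is the $p\times p$ identity matrix and $0_p$ the $p\times p$ zero matrix; for symmetric matrices $A<B$ means that $B-A$ is positive definite. Real symmetric $p\times p$ matrices $(m_{ij})$ are identified with the vector of entries $m_{ij}$, $1\le i\le j\le p$, in $\mathbb{R}^{p(p+1)/2}$, and densities are with respect to Lebesgue measure there. For $\gamma,\delta>\frac{p-1}{2}$, $J\beta E_p(\gamma,\delta)$ (real case, $\beta=1$) denotes the distribution on real symmetric $p\times p$ matrices with density proportional to $$(\det U)^{\gamma-\frac{p+1}{2}}\,(\det(I_p-U))^{\delta-\frac{p+1}{2}}\, I\{0_p<U<I_p\}.$$ $\beta(\gamma,\delta)$ denotes the Beta distribution on $[0,1]$ (density proportional to $x^{\gamma-1}(1-x)^{\delta-1}$). $M^{[k]}$ denotes the upper left $k\times k$ subblock of a matrix $M$. *)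

theory Defs
  imports
    "HOL-Probability.Probability"
    "Jordan_Normal_Form.Determinant"
begin

section \<open>Symmetric matrices and Lebesgue measure on them\<close>

definition symmetric_mat :: "nat \<Rightarrow> real mat \<Rightarrow> bool" where
  "symmetric_mat p A \<longleftrightarrow> A \<in> carrier_mat p p \<and> transpose_mat A = A"

definition pos_def :: "nat \<Rightarrow> real mat \<Rightarrow> bool" where
  "pos_def p A \<longleftrightarrow> symmetric_mat p A \<and>
     (\<forall>v \<in> carrier_vec p. v \<noteq> 0\<^sub>v p \<longrightarrow> 0 < scalar_prod v (A *\<^sub>v v))"

definition loewner_less :: "nat \<Rightarrow> real mat \<Rightarrow> real mat \<Rightarrow> bool" where
  "loewner_less p A B \<longleftrightarrow> pos_def p (B - A)"

text \<open>Rows and columns are numbered from \<open>0\<close>, so the independent entries of a symmetric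
  \<open>p \<times> p\<close> matrix are those at the positions \<open>(i, j)\<close> with \<open>i \<le> j < p\<close>.\<close>

definition upper_indices :: "nat \<Rightarrow> (nat \<times> nat) set" where
  "upper_indices p = {(i, j). i \<le> j \<and> j < p}"

definition sym_of_entries :: "nat \<Rightarrow> (nat \<times> nat \<Rightarrow> real) \<Rightarrow> real mat" where
  "sym_of_entries p x = mat p p (\<lambda>(i, j). x (min i j, max i j))"

text \<open>Lebesgue measure on the \<open>p (p + 1) / 2\<close> independent entries, transported to the matrices.
  The underlying space consists of exactly the symmetric \<open>p \<times> p\<close> matrices
  (\<open>space_lebesgue_sym\<close> below).\<close>

definition lebesgue_sym :: "nat \<Rightarrow> real mat measure" where
  "lebesgue_sym p =
     embed_measure (Pi\<^sub>M (upper_indices p) (\<lambda>_. lborel)) (sym_of_entries p)"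

lemma inj_on_sym_of_entries:
  "inj_on (sym_of_entries p) (space (Pi\<^sub>M (upper_indices p) (\<lambda>_. lborel)))"
proof (rule inj_onI)
  fix x y :: "nat \<times> nat \<Rightarrow> real"
  assume x: "x \<in> space (Pi\<^sub>M (upper_indices p) (\<lambda>_. lborel))"
    and y: "y \<in> space (Pi\<^sub>M (upper_indices p) (\<lambda>_. lborel))"
    and eq: "sym_of_entries p x = sym_of_entries p y"
  show "x = y"
  proof (rule PiE_ext)
    show "x \<in> upper_indices p \<rightarrow>\<^sub>E UNIV" "y \<in> upper_indices p \<rightarrow>\<^sub>E UNIV"
      using x y by (simp_all add: space_PiM)
    fix k assume "k \<in> upper_indices p"
    then obtain i j where k: "k = (i, j)" "i \<le> j" "j < p"
      by (auto simp: upper_indices_def)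
    have "sym_of_entries p x $$ (i, j) = sym_of_entries p y $$ (i, j)"
      by (simp add: eq)
    then show "x k = y k"
      using k by (simp add: sym_of_entries_def)
  qed
qed

lemma space_lebesgue_sym: "space (lebesgue_sym p) = {A. symmetric_mat p A}"
proof (intro Set.set_eqI iffI)
  fix A assume "A \<in> space (lebesgue_sym p)"
  then obtain x where "A = sym_of_entries p x"
    by (auto simp: lebesgue_sym_def space_embed_measure)
  then show "A \<in> {A. symmetric_mat p A}"
    by (auto simp: symmetric_mat_def sym_of_entries_def min.commute max.commute
        intro!: eq_matI)
next
  fix A assume "A \<in> {A. symmetric_mat p A}"
  then have A: "A \<in> carrier_mat p p" "transpose_mat A = A"
    by (auto simp: symmetric_mat_def)
  have sym: "A $$ (i, j) = A $$ (j, i)" if "i < p" "j < p" for i j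
    using A that by (metis carrier_matD index_transpose_mat(1))
  define x where "x = restrict (\<lambda>k. A $$ k) (upper_indices p)"
  have "A = sym_of_entries p x"
    using A(1) sym
    by (intro eq_matI)
      (auto simp: sym_of_entries_def x_def upper_indices_def min_def max_def)
  moreover have "x \<in> space (Pi\<^sub>M (upper_indices p) (\<lambda>_. lborel))"
    by (simp add: x_def space_PiM)
  ultimately show "A \<in> space (lebesgue_sym p)"
    by (auto simp: lebesgue_sym_def space_embed_measure)
qed

definition leading_block :: "nat \<Rightarrow> 'a mat \<Rightarrow> 'a mat" where
  "leading_block k A = mat k k (\<lambda>(i, j). A $$ (i, j))"

section \<open>Distributions\<close>

text \<open>The distribution whose density with respect to \<open>L\<close> is proportional to the nonnegative
  function \<open>f\<close>. This is meaningful when the integral of \<open>f\<close> is positive and finite.\<close>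

definition density_prop :: "'a measure \<Rightarrow> ('a \<Rightarrow> real) \<Rightarrow> 'a measure" where
  "density_prop L f =
     density L (\<lambda>x. ennreal (f x) / (\<integral>\<^sup>+ y. ennreal (f y) \<partial>L))"

definition matrix_beta :: "nat \<Rightarrow> real \<Rightarrow> real \<Rightarrow> real mat measure" where
  "matrix_beta p \<gamma> \<delta> = density_prop (lebesgue_sym p) (\<lambda>A.
     if loewner_less p (0\<^sub>m p p) A \<and> loewner_less p A (1\<^sub>m p)
     then Determinant.det A powr (\<gamma> - (real p + 1) / 2) *
          Determinant.det (1\<^sub>m p - A) powr (\<delta> - (real p + 1) / 2)
     else 0)"

definition beta_distribution :: "real \<Rightarrow> real \<Rightarrow> real measure" where
  "beta_distribution a b = density_prop lborel (\<lambda>x.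
     if 0 < x \<and> x < 1 then x powr (a - 1) * (1 - x) powr (b - 1) else 0)"

text \<open>\<open>X\<close> is a random element on \<open>M\<close> with law \<open>\<mu>\<close>; the target sigma-algebra is that of \<open>\<mu>\<close>.\<close>

definition has_law :: "'a measure \<Rightarrow> ('a \<Rightarrow> 'b) \<Rightarrow> 'b measure \<Rightarrow> bool" where
  "has_law M X \<mu> \<longleftrightarrow> X \<in> measurable M \<mu> \<and> distr M \<mu> X = \<mu>"

text \<open>Independence of two random elements with values in possibly different types; the library's
  \<open>indep_var\<close> requires both to have the same value type.\<close>

definition indep_rv ::
    "'a measure \<Rightarrow> 'b measure \<Rightarrow> ('a \<Rightarrow> 'b) \<Rightarrow> 'c measure \<Rightarrow> ('a \<Rightarrow> 'c) \<Rightarrow> bool" where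
  "indep_rv M S X T Y \<longleftrightarrow> X \<in> measurable M S \<and> Y \<in> measurable M T \<and>
     prob_space.indep_set M
       {X -` A \<inter> space M | A. A \<in> sets S} {Y -` B \<inter> space M | B. B \<in> sets T}"

end

theory Submission
  imports Defs
begin

text \<open>Write \<open>U\<close> as a block matrix with blocks \<open>V\<close>, \<open>u\<close>, \<open>w\<close> and let \<open>n = p - 1\<close>. By Schur complements,
  the two determinant ratios are \<open>a = w - u\<^sup>T V\<^sup>-\<^sup>1 u\<close> and \<open>b = 1 - w - u\<^sup>T (I - V)\<^sup>-\<^sup>1 u\<close>, and \<open>0 < U < I\<close>
  means \<open>0 < V < I\<close>, \<open>a > 0\<close>, \<open>b > 0\<close>. For fixed \<open>V\<close>, replace \<open>w\<close> by \<open>a\<close>; then \<open>b = 1 - a - u\<^sup>T A u\<close>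
  with \<open>A = V\<^sup>-\<^sup>1 + (I - V)\<^sup>-\<^sup>1\<close>, and \<open>det A = 1 / (det V det (I - V))\<close>. The form \<open>u\<^sup>T A u\<close> pushes Lebesgue
  measure forward to a constant times \<open>(det A) powr (-1/2) * s powr (n/2 - 1) ds\<close>, so the joint density
  factors into the matrix beta density of \<open>V\<close> and a Dirichlet density of \<open>(a, b)\<close>, which is also the density of
  \<open>(P1, (1 - P1) P2)\<close>. No constant has to be evaluated, because both sides are probability measures.\<close>

section \<open>Positive definite matrices and Schur complements\<close>

text \<open>The border vector u has n coordinates, and diagonalising the form in u would call for a
  multivariate change of variables. Completing the square one coordinate at a time replaces it by
  translations and substitutions on the real line, so all steps are Tonelli for nonnegative
  integrands.

  The exponents fit for one reason. Going from size n + 1 to size n, the number (p + 1)/2 drops by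
  1/2, so the powers of det V and det (I - V) have to gain 1/2 each. The factor (det A) powr (-1/2)
  is exactly (det V det (I - V)) powr (1/2). Hence V keeps the parameters \<gamma> and \<delta>, and
  the remaining factor is the Dirichlet density with parameters \<gamma> - n/2, \<delta> - n/2, n/2.

  Independence is carried by the order of quantifiers: each integral identity provides one constant
  for all V and all test functions.\<close>

definition quad_form :: "nat \<Rightarrow> real mat \<Rightarrow> (nat \<Rightarrow> real) \<Rightarrow> real" where
  "quad_form n A x = (\<Sum>i<n. \<Sum>j<n. A $$ (i, j) * x i * x j)"

lemma scalar_prod_mult_mat_vec_eq_quad_form:
  assumes "A \<in> carrier_mat n n" "v \<in> carrier_vec n"
  shows "scalar_prod v (A *\<^sub>v v) = quad_form n A (vec_index v)"
  using assms
  by (auto simp: quad_form_def scalar_prod_def sum_distrib_left atLeast0LessThan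
      intro!: sum.cong)

lemma quad_form_cong:
  assumes "\<And>i. i < n \<Longrightarrow> x i = y i"
  shows "quad_form n A x = quad_form n A y"
  unfolding quad_form_def using assms by (intro sum.cong refl) auto

text \<open>Nonzero vectors become functions that are nonzero somewhere below \<open>n\<close>.
  Points of a product space can then serve as vectors, be updated in one coordinate, and take any
  value outside the index range.\<close>

lemma pos_def_iff_quad_form:
  "pos_def n A \<longleftrightarrow> symmetric_mat n A \<and> (\<forall>x. (\<exists>i<n. x i \<noteq> 0) \<longrightarrow> 0 < quad_form n A x)"
proof (cases "symmetric_mat n A")
  case True
  then have A: "A \<in> carrier_mat n n" by (simp add: symmetric_mat_def)
  have "(\<forall>v\<in>carrier_vec n. v \<noteq> 0\<^sub>v n \<longrightarrow> 0 < scalar_prod v (A *\<^sub>v v))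
    \<longleftrightarrow> (\<forall>x. (\<exists>i<n. x i \<noteq> 0) \<longrightarrow> 0 < quad_form n A x)" (is "?l \<longleftrightarrow> ?r")
  proof
    assume l: ?l
    show ?r
    proof (intro allI impI)
      fix x :: "nat \<Rightarrow> real" assume "\<exists>i<n. x i \<noteq> 0"
      then have "vec n x \<noteq> 0\<^sub>v n" by (metis index_vec index_zero_vec(1))
      with l have "0 < scalar_prod (vec n x) (A *\<^sub>v vec n x)" by simp
      also have "\<dots> = quad_form n A (vec_index (vec n x))"
        by (rule scalar_prod_mult_mat_vec_eq_quad_form[OF A]) simp
      also have "\<dots> = quad_form n A x" by (rule quad_form_cong) simp
      finally show "0 < quad_form n A x" .
    qed
  next
    assume r: ?r
    show ?l
    proof (intro ballI impI)
      fix v :: "real vec" assume v: "v \<in> carrier_vec n" "v \<noteq> 0\<^sub>v n"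
      then have "\<exists>i<n. vec_index v i \<noteq> 0"
        by (metis carrier_vecD eq_vecI index_zero_vec)
      with r show "0 < scalar_prod v (A *\<^sub>v v)"
        using scalar_prod_mult_mat_vec_eq_quad_form[OF A v(1)] by simp
    qed
  qed
  with True show ?thesis by (simp add: pos_def_def)
qed (simp add: pos_def_def)

lemma symmetric_mat_entry:
  assumes "symmetric_mat n A" "i < n" "j < n"
  shows "A $$ (j, i) = A $$ (i, j)"
  using assms by (metis carrier_matD index_transpose_mat(1) symmetric_mat_def)

lemma symmetric_matI:
  assumes "A \<in> carrier_mat n n" "\<And>i j. i < n \<Longrightarrow> j < n \<Longrightarrow> A $$ (j, i) = A $$ (i, j)"
  shows "symmetric_mat n A"
  using assms unfolding symmetric_mat_def by (auto intro!: eq_matI)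

lemma leading_block_carrier [simp]: "leading_block k A \<in> carrier_mat k k"
  by (simp add: leading_block_def)

lemma dim_leading_block [simp]:
  "dim_row (leading_block k A) = k" "dim_col (leading_block k A) = k"
  by (simp_all add: leading_block_def)

lemma leading_block_index [simp]: "i < k \<Longrightarrow> j < k \<Longrightarrow> leading_block k A $$ (i, j) = A $$ (i, j)"
  by (simp add: leading_block_def)

lemma symmetric_leading_block:
  assumes "symmetric_mat n A" "k \<le> n"
  shows "symmetric_mat k (leading_block k A)"
  using assms by (intro symmetric_matI) (auto intro: symmetric_mat_entry)

lemma leading_block_one_minus:
  assumes "A \<in> carrier_mat n n" "k \<le> n"
  shows "leading_block k (1\<^sub>m n - A) = 1\<^sub>m k - leading_block k A"
  using assms by (intro eq_matI) (auto simp: leading_block_def)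

lemma quad_form_Suc:
  assumes "symmetric_mat (Suc n) A"
  shows "quad_form (Suc n) A x = quad_form n (leading_block n A) x
    + 2 * x n * (\<Sum>i<n. A $$ (i, n) * x i) + A $$ (n, n) * (x n)\<^sup>2"
proof -
  have 1: "(\<Sum>j<n. A $$ (n, j) * x n * x j) = x n * (\<Sum>i<n. A $$ (i, n) * x i)"
    unfolding sum_distrib_left
    by (intro sum.cong) (auto simp: symmetric_mat_entry[OF assms, of _ n])
  have 2: "(\<Sum>i<n. A $$ (i, n) * x i * x n) = x n * (\<Sum>i<n. A $$ (i, n) * x i)"
    unfolding sum_distrib_left by (intro sum.cong) auto
  have 3: "quad_form n (leading_block n A) x = (\<Sum>i<n. \<Sum>j<n. A $$ (i, j) * x i * x j)"
    unfolding quad_form_def by (intro sum.cong) auto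
  show ?thesis
    unfolding 3 by (simp add: quad_form_def sum.distrib 1 2 power2_eq_square)
qed

text \<open>The vector \<open>c\<close> is the inverse of the leading block applied to the last
  column u; assuming only the linear system keeps inverses out of the computation. In the expanded
  shifted form, each of the two mixed terms collapses to \<open>x n\<close> times the product of u
  and x, and the term quadratic in \<open>c\<close> to the product of u and c, which the Schur
  complement takes away again.\<close>

lemma quad_form_Suc_complete_square:
  assumes A: "symmetric_mat (Suc n) A"
    and c: "\<And>i. i < n \<Longrightarrow> (\<Sum>j<n. A $$ (i, j) * c j) = A $$ (i, n)"
  shows "quad_form (Suc n) A x = quad_form n (leading_block n A) (\<lambda>i. x i + x n * c i)
    + (A $$ (n, n) - (\<Sum>i<n. A $$ (i, n) * c i)) * (x n)\<^sup>2"
proof -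
  let ?t = "x n"
  have "quad_form n (leading_block n A) (\<lambda>i. x i + ?t * c i)
    = (\<Sum>i<n. \<Sum>j<n. A $$ (i, j) * x i * x j) + ?t * (\<Sum>i<n. \<Sum>j<n. A $$ (i, j) * x i * c j)
      + ?t * (\<Sum>i<n. \<Sum>j<n. A $$ (i, j) * c i * x j)
      + ?t\<^sup>2 * (\<Sum>i<n. \<Sum>j<n. A $$ (i, j) * c i * c j)"
    unfolding quad_form_def sum_distrib_left sum.distrib[symmetric]
    by (intro sum.cong refl) (auto simp: algebra_simps power2_eq_square)
  moreover have "(\<Sum>i<n. \<Sum>j<n. A $$ (i, j) * x i * c j) = (\<Sum>i<n. A $$ (i, n) * x i)"
  proof (intro sum.cong refl)
    fix i assume "i \<in> {..<n}"
    then have A_in: "A $$ (i, n) = (\<Sum>j<n. A $$ (i, j) * c j)" using c by simp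
    show "(\<Sum>j<n. A $$ (i, j) * x i * c j) = A $$ (i, n) * x i"
      unfolding A_in sum_distrib_right by (intro sum.cong) auto
  qed
  moreover have "(\<Sum>i<n. \<Sum>j<n. A $$ (i, j) * c i * x j) = (\<Sum>i<n. A $$ (i, n) * x i)"
  proof -
    have "(\<Sum>i<n. \<Sum>j<n. A $$ (i, j) * c i * x j) = (\<Sum>j<n. \<Sum>i<n. A $$ (i, j) * c i * x j)"
      by (rule sum.swap)
    also have "\<dots> = (\<Sum>j<n. A $$ (j, n) * x j)"
    proof (intro sum.cong refl)
      fix j assume j: "j \<in> {..<n}"
      then have "A $$ (j, n) = (\<Sum>i<n. A $$ (j, i) * c i)" using c by simp
      also have "\<dots> = (\<Sum>i<n. A $$ (i, j) * c i)"
        using j by (intro sum.cong) (auto simp: symmetric_mat_entry[OF A, of j])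
      finally have A_jn: "A $$ (j, n) = (\<Sum>i<n. A $$ (i, j) * c i)" .
      show "(\<Sum>i<n. A $$ (i, j) * c i * x j) = A $$ (j, n) * x j"
        unfolding A_jn sum_distrib_right by simp
    qed
    finally show ?thesis .
  qed
  moreover have "(\<Sum>i<n. \<Sum>j<n. A $$ (i, j) * c i * c j) = (\<Sum>i<n. A $$ (i, n) * c i)"
  proof (intro sum.cong refl)
    fix i assume "i \<in> {..<n}"
    then have A_in: "A $$ (i, n) = (\<Sum>j<n. A $$ (i, j) * c j)" using c by simp
    show "(\<Sum>j<n. A $$ (i, j) * c i * c j) = A $$ (i, n) * c i"
      unfolding A_in sum_distrib_right by (intro sum.cong) auto
  qed
  moreover have "quad_form n (leading_block n A) x = (\<Sum>i<n. \<Sum>j<n. A $$ (i, j) * x i * x j)"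
    unfolding quad_form_def by (intro sum.cong) auto
  ultimately show ?thesis
    unfolding quad_form_Suc[OF A] by (simp add: algebra_simps)
qed

text \<open>Right multiplication by the unit triangular matrix \<open>E\<close> subtracts from the
  last column the combination of the other columns with weights \<open>c\<close>. By the system for
  \<open>c\<close> this clears the column above the corner, so the product is block lower triangular
  with the Schur complement in the corner.\<close>

lemma det_Suc_schur:
  assumes A: "A \<in> carrier_mat (Suc n) (Suc n)"
    and c: "\<And>i. i < n \<Longrightarrow> (\<Sum>j<n. A $$ (i, j) * c j) = A $$ (i, n)"
  shows "Determinant.det A = Determinant.det (leading_block n A)
    * (A $$ (n, n) - (\<Sum>i<n. A $$ (n, i) * c i :: real))"
proof -
  define E where "E = mat (Suc n) (Suc n)
    (\<lambda>(i, j). if i = j then 1 else if j = n then - c i else 0)"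
  have E: "E \<in> carrier_mat (Suc n) (Suc n)" by (simp add: E_def)
  have detE: "Determinant.det E = 1"
  proof -
    have "upper_triangular E" unfolding upper_triangular_def E_def by auto
    moreover have "prod_list (diag_mat E) = 1"
      unfolding prod_list_diag_prod E_def by (auto intro!: prod.neutral)
    ultimately show ?thesis using det_upper_triangular[OF _ E] by simp
  qed
  let ?s = "A $$ (n, n) - (\<Sum>i<n. A $$ (n, i) * c i)"
  have col: "(A * E) $$ (i, n) = A $$ (i, n) - (\<Sum>j<n. A $$ (i, j) * c j)" if "i < Suc n" for i
    using A that by (auto simp: E_def scalar_prod_def sum_negf[symmetric] intro!: sum.cong)
  have rest: "(A * E) $$ (i, j) = A $$ (i, j)" if "i < Suc n" "j < n" for i j
  proof -
    have "(A * E) $$ (i, j) = (\<Sum>k = 0..<Suc n. A $$ (i, k) * (if k = j then 1 else 0))"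
      using A that by (auto simp: E_def scalar_prod_def intro!: sum.cong)
    also have "\<dots> = A $$ (i, j)" using that by (simp add: if_distrib[of "\<lambda>x. _ * x"] sum.delta cong: if_cong)
    finally show ?thesis .
  qed
  have "A * E = four_block_mat (leading_block n A) (0\<^sub>m n 1)
     (mat 1 n (\<lambda>(i, j). A $$ (n, j))) (mat 1 1 (\<lambda>_. ?s))"
    using A E
  proof (intro eq_matI, goal_cases)
    case (1 i j)
    then have ij: "i < Suc n" "j < Suc n" by auto
    show ?case
    proof (cases "j = n")
      case True
      then show ?thesis using ij col[of i] c[of i] by (cases "i = n") (auto simp: leading_block_def)
    next
      case False
      then show ?thesis using ij rest[of i j] by (cases "i = n") (auto simp: leading_block_def)
    qed
  qed (auto simp: leading_block_def)
  then have "Determinant.det (A * E) = Determinant.det (leading_block n A) * ?s"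
    by (simp add: det_four_block_mat_upper_right_zero_col[where n = n] det_single)
  then show ?thesis using det_mult[OF A E] detE by simp
qed

section \<open>Inverses and determinants of positive definite matrices\<close>

lemma pos_def_quad_form_pos:
  assumes "pos_def n A" "i < n" "x i \<noteq> 0"
  shows "0 < quad_form n A x"
proof -
  have "(\<exists>i<n. x i \<noteq> 0) \<longrightarrow> 0 < quad_form n A x"
    using assms(1) unfolding pos_def_iff_quad_form by (elim conjE) (erule spec)
  then show ?thesis using assms(2,3) by blast
qed

lemma pos_def_imp_det_nonzero:
  assumes "pos_def n A"
  shows "Determinant.det A \<noteq> 0"
proof
  assume "Determinant.det A = 0"
  moreover have A: "A \<in> carrier_mat n n"
    using assms by (simp add: pos_def_def symmetric_mat_def)
  ultimately obtain v where "v \<in> carrier_vec n" "v \<noteq> 0\<^sub>v n" "A *\<^sub>v v = 0\<^sub>v n"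
    using det_0_iff_vec_prod_zero_field[OF A] by blast
  then show False using assms by (force simp: pos_def_def)
qed

text \<open>Symmetry of the inverse B follows from B^T = B^T A B = (A B)^T B = B. It is positive
  because its form at v is the form of A at w = B v.\<close>

lemma pos_def_obtain_inverse:
  assumes A: "pos_def n A"
  obtains B where "pos_def n B" "A * B = 1\<^sub>m n" "B * A = 1\<^sub>m n"
proof -
  have cA: "A \<in> carrier_mat n n" and tA: "transpose_mat A = A"
    using A by (auto simp: pos_def_def symmetric_mat_def)
  from det_non_zero_imp_unit[OF cA pos_def_imp_det_nonzero[OF A], of "()"]
  obtain B where B: "B \<in> carrier_mat n n" "A * B = 1\<^sub>m n" "B * A = 1\<^sub>m n"
    by (auto simp: Units_def ring_mat_def)
  have "transpose_mat B = transpose_mat B * (A * B)" using B by simp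
  also have "\<dots> = (transpose_mat B * A) * B"
    by (rule assoc_mult_mat[symmetric]) (use B cA in auto)
  also have "transpose_mat B * A = transpose_mat (A * B)"
    unfolding transpose_mult[OF cA B(1)] tA ..
  finally have tB: "transpose_mat B = B" using B by simp
  have "pos_def n B"
    unfolding pos_def_def symmetric_mat_def
  proof (intro conjI ballI impI)
    fix v :: "real vec" assume v: "v \<in> carrier_vec n" "v \<noteq> 0\<^sub>v n"
    let ?w = "B *\<^sub>v v"
    have "A *\<^sub>v ?w = (A * B) *\<^sub>v v"
      by (rule assoc_mult_mat_vec[symmetric, OF cA B(1) v(1)])
    then have Aw: "A *\<^sub>v ?w = v" using v B(2) by simp
    have "?w \<noteq> 0\<^sub>v n"
    proof
      assume "?w = 0\<^sub>v n"
      then have "A *\<^sub>v ?w = 0\<^sub>v n" using cA by auto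
      with Aw v(2) show False by metis
    qed
    moreover have "?w \<in> carrier_vec n" using B(1) v(1) by simp
    ultimately have "0 < scalar_prod ?w (A *\<^sub>v ?w)" using A unfolding pos_def_def by blast
    also have "\<dots> = scalar_prod v ?w"
      unfolding Aw by (rule comm_scalar_prod) (use B v in auto)
    finally show "0 < scalar_prod v (B *\<^sub>v v)" .
  qed (use B tB in auto)
  then show thesis using that B by blast
qed

text \<open>Supplies the \<open>c\<close> on which the completed square and the determinant formula
  depend.\<close>

lemma pos_def_obtain_schur:
  assumes V: "pos_def n (leading_block n A)" and A: "symmetric_mat (Suc n) A"
  obtains c where "\<And>i. i < n \<Longrightarrow> (\<Sum>j<n. A $$ (i, j) * c j) = A $$ (i, n)"
proof -
  obtain B where B: "leading_block n A * B = 1\<^sub>m n" "pos_def n B"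
    using pos_def_obtain_inverse[OF V] by blast
  then have cB: "B \<in> carrier_mat n n" by (auto simp: pos_def_def symmetric_mat_def)
  let ?u = "vec n (\<lambda>i. A $$ (i, n))"
  have *: "leading_block n A *\<^sub>v (B *\<^sub>v ?u) = ?u"
    using B cB by (simp add: assoc_mult_mat_vec[symmetric, of _ n n _ n])
  have "(\<Sum>j<n. A $$ (i, j) * vec_index (B *\<^sub>v ?u) j) = A $$ (i, n)" if i: "i < n" for i
  proof -
    have "(\<Sum>j<n. A $$ (i, j) * vec_index (B *\<^sub>v ?u) j)
      = vec_index (leading_block n A *\<^sub>v (B *\<^sub>v ?u)) i"
      using i cB by (subst index_mult_mat_vec)
        (auto simp: scalar_prod_def leading_block_def atLeast0LessThan simp del: index_mult_mat_vec
          intro!: sum.cong)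
    then show ?thesis using * i by simp
  qed
  then show thesis by (rule that)
qed

lemma pos_def_leading_block:
  assumes "pos_def (Suc n) A"
  shows "pos_def n (leading_block n A)"
  unfolding pos_def_iff_quad_form
proof (intro conjI allI impI)
  have A: "symmetric_mat (Suc n) A" using assms by (simp add: pos_def_def)
  then show "symmetric_mat n (leading_block n A)" by (rule symmetric_leading_block) simp
  fix x :: "nat \<Rightarrow> real" assume x: "\<exists>i<n. x i \<noteq> 0"
  then obtain i where "i < n" "x i \<noteq> 0" by blast
  then have "0 < quad_form (Suc n) A (x(n := 0))"
    by (intro pos_def_quad_form_pos[OF assms, of i]) auto
  also have "\<dots> = quad_form n (leading_block n A) (x(n := 0))"
    by (simp add: quad_form_Suc[OF A])
  also have "\<dots> = quad_form n (leading_block n A) x"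
    by (rule quad_form_cong) simp
  finally show "0 < quad_form n (leading_block n A) x" .
qed

text \<open>The completed square writes the form as a positive definite form in
  \<open>x i + x n * c i\<close> plus the Schur complement times the square of \<open>x n\<close>,
  so only the sign of the Schur complement remains open.\<close>

lemma pos_def_Suc_iff_schur:
  assumes A: "symmetric_mat (Suc n) A"
    and c: "\<And>i. i < n \<Longrightarrow> (\<Sum>j<n. A $$ (i, j) * c j) = A $$ (i, n)"
    and V: "pos_def n (leading_block n A)"
  shows "pos_def (Suc n) A \<longleftrightarrow> 0 < A $$ (n, n) - (\<Sum>i<n. A $$ (i, n) * c i)" (is "_ \<longleftrightarrow> 0 < ?s")
proof
  assume pd: "pos_def (Suc n) A"
  \<comment> \<open>At this vector the completed square vanishes and only the Schur complement is
    left.\<close>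
  let ?x = "\<lambda>i. if i = n then 1 else - c i"
  have "0 < quad_form (Suc n) A ?x"
    by (intro pos_def_quad_form_pos[OF pd, of n]) auto
  also have "\<dots> = quad_form n (leading_block n A) (\<lambda>i. ?x i + ?x n * c i) + ?s * (?x n)\<^sup>2"
    by (rule quad_form_Suc_complete_square[OF A c, where x = ?x])
  also have "quad_form n (leading_block n A) (\<lambda>i. ?x i + ?x n * c i)
    = quad_form n (leading_block n A) (\<lambda>i. 0)"
    by (rule quad_form_cong) simp
  finally show "0 < ?s" by (simp add: quad_form_def)
next
  assume s: "0 < ?s"
  show "pos_def (Suc n) A"
    unfolding pos_def_iff_quad_form
  proof (intro conjI allI impI A)
    fix x :: "nat \<Rightarrow> real" assume x: "\<exists>i<Suc n. x i \<noteq> 0"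
    let ?y = "\<lambda>i. x i + x n * c i"
    have *: "quad_form (Suc n) A x = quad_form n (leading_block n A) ?y + ?s * (x n)\<^sup>2"
      by (rule quad_form_Suc_complete_square[OF A c, where x = x])
    show "0 < quad_form (Suc n) A x"
    proof (cases "\<exists>i<n. ?y i \<noteq> 0")
      case True
      then obtain i where i: "i < n" "?y i \<noteq> 0" by blast
      have "0 < quad_form n (leading_block n A) ?y"
        using pos_def_quad_form_pos[OF V i(1), of ?y] i(2) by simp
      moreover have "0 \<le> ?s * (x n)\<^sup>2" using s by (intro mult_nonneg_nonneg) auto
      ultimately show ?thesis unfolding * by (rule add_pos_nonneg)
    next
      case False
      have "x n \<noteq> 0"
      proof
        assume "x n = 0"
        with False have "x i = 0" if "i < n" for i using that by auto
        with \<open>x n = 0\<close> x show False by (auto simp: less_Suc_eq)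
      qed
      then have "0 < ?s * (x n)\<^sup>2" using s by (intro mult_pos_pos) auto
      moreover have "quad_form n (leading_block n A) ?y = quad_form n (leading_block n A) (\<lambda>_. 0)"
        using False by (intro quad_form_cong) blast
      moreover have "quad_form n (leading_block n A) (\<lambda>_. 0) = 0" by (simp add: quad_form_def)
      ultimately show ?thesis unfolding * by linarith
    qed
  qed
qed

lemma det_Suc_schur_symmetric:
  assumes A: "symmetric_mat (Suc n) A"
    and c: "\<And>i. i < n \<Longrightarrow> (\<Sum>j<n. A $$ (i, j) * c j) = A $$ (i, n)"
  shows "Determinant.det A = Determinant.det (leading_block n A)
    * (A $$ (n, n) - (\<Sum>i<n. A $$ (i, n) * c i :: real))"
proof -
  have "(\<Sum>i<n. A $$ (n, i) * c i) = (\<Sum>i<n. A $$ (i, n) * c i)"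
    by (intro sum.cong) (auto simp: symmetric_mat_entry[OF A, of _ n])
  then show ?thesis using det_Suc_schur[OF _ c] A by (simp add: symmetric_mat_def)
qed

lemma pos_def_imp_det_pos: "pos_def n A \<Longrightarrow> 0 < Determinant.det A"
proof (induction n arbitrary: A)
  case 0
  then have "A \<in> carrier_mat 0 0" by (simp add: pos_def_def symmetric_mat_def)
  then show ?case by (simp add: det_dim_zero)
next
  case (Suc n)
  have V: "pos_def n (leading_block n A)" by (rule pos_def_leading_block[OF Suc.prems])
  have A: "symmetric_mat (Suc n) A" using Suc.prems by (simp add: pos_def_def)
  obtain c where c: "\<And>i. i < n \<Longrightarrow> (\<Sum>j<n. A $$ (i, j) * c j) = A $$ (i, n)"
    using pos_def_obtain_schur[OF V A] by blast
  show ?case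
    using Suc.IH[OF V] Suc.prems pos_def_Suc_iff_schur[OF A c V] det_Suc_schur_symmetric[OF A c]
    by simp
qed

text \<open>One step of Sylvester's criterion: given a positive definite leading block, the
  determinant and the Schur complement have the same sign.\<close>

lemma pos_def_Suc_iff:
  assumes A: "symmetric_mat (Suc n) A"
  shows "pos_def (Suc n) A \<longleftrightarrow> pos_def n (leading_block n A) \<and> 0 < Determinant.det A"
proof (cases "pos_def n (leading_block n A)")
  case V: True
  obtain c where c: "\<And>i. i < n \<Longrightarrow> (\<Sum>j<n. A $$ (i, j) * c j) = A $$ (i, n)"
    using pos_def_obtain_schur[OF V A] by blast
  show ?thesis
    using V pos_def_imp_det_pos[OF V] pos_def_Suc_iff_schur[OF A c V] det_Suc_schur_symmetric[OF A c]
    by (simp add: zero_less_mult_iff)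
qed (use pos_def_leading_block in blast)

lemma pos_def_add:
  assumes "pos_def n A" "pos_def n B"
  shows "pos_def n (A + B)"
proof -
  have c: "A \<in> carrier_mat n n" "B \<in> carrier_mat n n"
    using assms by (auto simp: pos_def_def symmetric_mat_def)
  have "symmetric_mat n (A + B)"
    using assms c by (auto simp: pos_def_def symmetric_mat_def transpose_add[of _ n n])
  moreover have "quad_form n (A + B) x = quad_form n A x + quad_form n B x" for x
    using c unfolding quad_form_def sum.distrib[symmetric]
    by (intro sum.cong) (auto simp: algebra_simps)
  ultimately show ?thesis
    using assms unfolding pos_def_iff_quad_form by (simp add: add_pos_pos)
qed

section \<open>Integrals of functions of a quadratic form\<close>

lemma nn_integral_lborel_shift:
  fixes f :: "real \<Rightarrow> ennreal"
  assumes [measurable]: "f \<in> borel_measurable borel"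
  shows "(\<integral>\<^sup>+x. f (x + t) \<partial>lborel) = (\<integral>\<^sup>+x. f x \<partial>lborel)"
  using nn_integral_real_affine[of f 1 t] by (simp add: add.commute)

text \<open>The substitution r = t^2 on the positive half line, with dr = 2 t dt. The factor 2 stays
  on the left, where it later accounts for the two half lines.\<close>

lemma nn_integral_power2_positive:
  fixes G :: "real \<Rightarrow> ennreal"
  assumes [measurable]: "G \<in> borel_measurable borel"
  shows "(\<integral>\<^sup>+t. 2 * G (t\<^sup>2) * indicator {0<..} t \<partial>lborel)
    = (\<integral>\<^sup>+r. G r * ennreal (r powr (- 1 / 2)) * indicator {0<..} r \<partial>lborel)"
proof -
  define f where "f r = G r * ennreal (r powr (- 1 / 2)) * indicator {0<..} r" for r
  have [measurable]: "f \<in> borel_measurable borel" unfolding f_def by measurable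
  \<comment> \<open>At r = t^2 the factor r powr (-1/2) cancels the t in the derivative 2 t.\<close>
  have pt: "f (t\<^sup>2) * ennreal (2 * t) * indicator {0..real n} t
    = 2 * G (t\<^sup>2) * indicator {0<..real n} t" for t n
  proof (cases "0 < t")
    case True
    have "t\<^sup>2 = t powr 2" using True by simp
    then have "(t\<^sup>2) powr (- 1 / 2) = t powr (- 1)" by (simp only: powr_powr) simp
    then have "(t\<^sup>2) powr (- 1 / 2) * (2 * t) = 2" using True by (simp add: powr_minus)
    then have "ennreal ((t\<^sup>2) powr (- 1 / 2)) * ennreal (2 * t) = 2"
      by (metis ennreal_mult' ennreal_numeral powr_ge_zero zero_le_numeral)
    then have "G (t\<^sup>2) * (ennreal ((t\<^sup>2) powr (- 1 / 2)) * ennreal (2 * t)) = 2 * G (t\<^sup>2)"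
      by (simp add: mult.commute)
    then show ?thesis using True by (auto simp: f_def indicator_def mult.assoc)
  next
    case False
    then show ?thesis by (auto simp: f_def indicator_def)
  qed
  \<comment> \<open>The substitution is made on bounded intervals and extended to the half line by
    monotone convergence on both sides; \<open>Suc n\<close> keeps the intervals
    nondegenerate.\<close>
  have step: "(\<integral>\<^sup>+r. f r * indicator {0..(real (Suc n))\<^sup>2} r \<partial>lborel)
    = (\<integral>\<^sup>+t. 2 * G (t\<^sup>2) * indicator {0<..real (Suc n)} t \<partial>lborel)" for n
  proof -
    have "(\<integral>\<^sup>+r. f r * indicator {(0::real)\<^sup>2..(real (Suc n))\<^sup>2} r \<partial>lborel)
      = (\<integral>\<^sup>+t. f (t\<^sup>2) * ennreal (2 * t) * indicator {0..real (Suc n)} t \<partial>lborel)"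
      by (rule nn_integral_substitution_aux[where f = f and g = "\<lambda>t. t\<^sup>2" and g' = "\<lambda>t. 2 * t"])
        (auto intro!: derivative_eq_intros continuous_intros)
    then show ?thesis by (simp only: pt) simp
  qed
  have "(\<integral>\<^sup>+r. f r \<partial>lborel) = (\<integral>\<^sup>+r. (SUP n. f r * indicator {0..(real (Suc n))\<^sup>2} r) \<partial>lborel)"
  proof (rule nn_integral_cong)
    fix r :: real
    obtain n where "r \<le> real n" using real_arch_simple by blast
    also have "real n \<le> (real (Suc n))\<^sup>2"
      using self_le_power[of "real (Suc n)" 2] by linarith
    finally have n: "r \<le> (real (Suc n))\<^sup>2" .
    show "f r = (SUP n. f r * indicator {0..(real (Suc n))\<^sup>2} r)"
    proof (rule antisym)
      have "f r \<le> f r * indicator {0..(real (Suc n))\<^sup>2} r"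
        using n by (cases "0 < r") (auto simp: f_def)
      also have "\<dots> \<le> (SUP n. f r * indicator {0..(real (Suc n))\<^sup>2} r)" by (rule SUP_upper) simp
      finally show "f r \<le> (SUP n. f r * indicator {0..(real (Suc n))\<^sup>2} r)" .
    qed (auto intro!: SUP_least simp: indicator_def)
  qed
  also have "\<dots> = (SUP n. \<integral>\<^sup>+r. f r * indicator {0..(real (Suc n))\<^sup>2} r \<partial>lborel)"
  proof (rule nn_integral_monotone_convergence_SUP)
    have "f r * indicator {0..(real (Suc m))\<^sup>2} r \<le> f r * indicator {0..(real (Suc n))\<^sup>2} r"
      if "m \<le> n" for m n r
    proof -
      have "(real (Suc m))\<^sup>2 \<le> (real (Suc n))\<^sup>2" using that by (intro power_mono) auto
      then have "{0..(real (Suc m))\<^sup>2} \<subseteq> {0..(real (Suc n))\<^sup>2}"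
        by (simp only: atLeastatMost_subset_iff) simp
      then show ?thesis by (auto simp: indicator_def subset_eq simp del: of_nat_Suc)
    qed
    then show "incseq (\<lambda>n r. f r * indicator {0..(real (Suc n))\<^sup>2} r)"
      unfolding incseq_def le_fun_def by blast
  qed measurable
  also have "\<dots> = (SUP n. \<integral>\<^sup>+t. 2 * G (t\<^sup>2) * indicator {0<..real (Suc n)} t \<partial>lborel)"
    by (simp only: step)
  also have "\<dots> = (\<integral>\<^sup>+t. (SUP n. 2 * G (t\<^sup>2) * indicator {0<..real (Suc n)} t) \<partial>lborel)"
    by (rule nn_integral_monotone_convergence_SUP[symmetric])
      (auto simp: incseq_def le_fun_def indicator_def)
  also have "\<dots> = (\<integral>\<^sup>+t. 2 * G (t\<^sup>2) * indicator {0<..} t \<partial>lborel)"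
  proof (rule nn_integral_cong)
    fix t :: real
    obtain n where n: "t \<le> real n" using real_arch_simple by blast
    show "(SUP n. 2 * G (t\<^sup>2) * indicator {0<..real (Suc n)} t) = 2 * G (t\<^sup>2) * indicator {0<..} t"
    proof (rule antisym)
      have "2 * G (t\<^sup>2) * indicator {0<..} t \<le> 2 * G (t\<^sup>2) * indicator {0<..real (Suc n)} t"
        using n by (auto simp: indicator_def)
      also have "\<dots> \<le> (SUP n. 2 * G (t\<^sup>2) * indicator {0<..real (Suc n)} t)" by (rule SUP_upper) simp
      finally show "2 * G (t\<^sup>2) * indicator {0<..} t
        \<le> (SUP n. 2 * G (t\<^sup>2) * indicator {0<..real (Suc n)} t)" .
    qed (auto intro!: SUP_least simp: indicator_def)
  qed
  finally show ?thesis by (simp add: f_def)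
qed

text \<open>The integrand is even, so both half lines contribute the same amount, and the origin is
  a null set.\<close>

lemma nn_integral_power2:
  fixes G :: "real \<Rightarrow> ennreal"
  assumes [measurable]: "G \<in> borel_measurable borel"
  shows "(\<integral>\<^sup>+t. G (t\<^sup>2) \<partial>lborel)
    = (\<integral>\<^sup>+r. G r * ennreal (r powr (- 1 / 2)) * indicator {0<..} r \<partial>lborel)"
proof -
  let ?I = "\<integral>\<^sup>+t. G (t\<^sup>2) * indicator {0<..} t \<partial>lborel"
  have "(\<integral>\<^sup>+t. G (t\<^sup>2) * indicator {..<0} t \<partial>lborel)
    = (\<integral>\<^sup>+t. G ((- t)\<^sup>2) * indicator {..<0} (- t :: real) \<partial>lborel)"
    using nn_integral_real_affine[of "\<lambda>t. G (t\<^sup>2) * indicator {..<0} t" "-1" 0] by simp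
  also have "\<dots> = ?I" by (intro nn_integral_cong) (auto simp: indicator_def)
  finally have neg: "(\<integral>\<^sup>+t. G (t\<^sup>2) * indicator {..<0} t \<partial>lborel) = ?I" .
  have "AE t in lborel. t \<noteq> (0::real)" by (rule AE_lborel_singleton)
  then have "(\<integral>\<^sup>+t. G (t\<^sup>2) \<partial>lborel)
    = (\<integral>\<^sup>+t. G (t\<^sup>2) * indicator {..<0} t + G (t\<^sup>2) * indicator {0<..} t \<partial>lborel)"
    by (intro nn_integral_cong_AE) (auto simp: indicator_def)
  also have "\<dots> = ?I + ?I" by (subst nn_integral_add) (auto simp: neg)
  also have "\<dots> = 2 * ?I" by (rule mult_2[symmetric])
  also have "\<dots> = (\<integral>\<^sup>+t. 2 * G (t\<^sup>2) * indicator {0<..} t \<partial>lborel)"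
    unfolding mult.assoc by (rule nn_integral_cmult[symmetric]) measurable
  finally show ?thesis unfolding nn_integral_power2_positive[OF assms] .
qed

text \<open>Rescaling t by \<open>sqrt s\<close> reduces this to s = 1. It is the one-dimensional
  case of the pushforward by a quadratic form, with s as the determinant.\<close>

lemma nn_integral_scaled_power2:
  fixes G :: "real \<Rightarrow> ennreal"
  assumes [measurable]: "G \<in> borel_measurable borel" and "0 < s"
  shows "(\<integral>\<^sup>+t. G (s * t\<^sup>2) \<partial>lborel) = ennreal (s powr (- 1 / 2))
    * (\<integral>\<^sup>+r. G r * ennreal (r powr (- 1 / 2)) * indicator {0<..} r \<partial>lborel)"
proof -
  have s: "sqrt s * s powr (- 1 / 2) = 1"
    using \<open>0 < s\<close> by (simp add: powr_minus powr_half_sqrt[symmetric] field_simps)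
  have "(\<integral>\<^sup>+t. G (t\<^sup>2) \<partial>lborel) = ennreal (sqrt s) * (\<integral>\<^sup>+t. G (s * t\<^sup>2) \<partial>lborel)"
    using nn_integral_real_affine[of "\<lambda>t. G (t\<^sup>2)" "sqrt s" 0] \<open>0 < s\<close>
    by (simp add: power_mult_distrib)
  then have "ennreal (s powr (- 1 / 2)) * (\<integral>\<^sup>+t. G (t\<^sup>2) \<partial>lborel)
    = ennreal (sqrt s * s powr (- 1 / 2)) * (\<integral>\<^sup>+t. G (s * t\<^sup>2) \<partial>lborel)"
    using \<open>0 < s\<close> by (simp add: ennreal_mult mult_ac)
  then show ?thesis unfolding s nn_integral_power2[OF assms(1)] by simp
qed

text \<open>Euler's beta integral, as an extended real so that no convergence has to be
  checked.\<close>

definition beta_const :: "real \<Rightarrow> real \<Rightarrow> ennreal" where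
  "beta_const a b = (\<integral>\<^sup>+z. ennreal (z powr (a - 1)) * ennreal ((1 - z) powr (b - 1))
     * indicator {0<..<1} z \<partial>lborel)"

text \<open>The powers with exponents a - 1 and b - 1 on the half line convolve to a multiple of the
  power with exponent a + b - 1. After the translation v = s + r and Tonelli, the inner integral
  over 0 < s < v scales to a beta integral.\<close>

lemma nn_integral_powr_convolution:
  fixes g :: "real \<Rightarrow> ennreal"
  assumes [measurable]: "g \<in> borel_measurable borel"
  shows "(\<integral>\<^sup>+s. (\<integral>\<^sup>+r. g (s + r) * ennreal (r powr (b - 1)) * indicator {0<..} r \<partial>lborel)
      * ennreal (s powr (a - 1)) * indicator {0<..} s \<partial>lborel)
    = beta_const a b * (\<integral>\<^sup>+v. g v * ennreal (v powr (a + b - 1)) * indicator {0<..} v \<partial>lborel)"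
    (is "?L = _")
proof -
  have inner: "(\<integral>\<^sup>+r. g (s + r) * ennreal (r powr (b - 1)) * indicator {0<..} r \<partial>lborel)
    = (\<integral>\<^sup>+v. g v * ennreal ((v - s) powr (b - 1)) * indicator {0<..} (v - s) \<partial>lborel)" for s
    using nn_integral_lborel_shift[of
        "\<lambda>v. g v * ennreal ((v - s) powr (b - 1)) * indicator {0<..} (v - s)" s]
    by (simp add: add.commute)
  have "?L = (\<integral>\<^sup>+s. (\<integral>\<^sup>+v. g v * ennreal ((v - s) powr (b - 1)) * indicator {0<..} (v - s) \<partial>lborel)
      * ennreal (s powr (a - 1)) * indicator {0<..} s \<partial>lborel)"
    by (simp only: inner)
  also have "\<dots> = (\<integral>\<^sup>+s. \<integral>\<^sup>+v. g v * ennreal ((v - s) powr (b - 1)) * indicator {0<..} (v - s)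
      * (ennreal (s powr (a - 1)) * indicator {0<..} s) \<partial>lborel \<partial>lborel)"
    by (subst nn_integral_multc) (auto simp: mult.assoc)
  also have "\<dots> = (\<integral>\<^sup>+v. \<integral>\<^sup>+s. g v * ennreal ((v - s) powr (b - 1)) * indicator {0<..} (v - s)
      * (ennreal (s powr (a - 1)) * indicator {0<..} s) \<partial>lborel \<partial>lborel)"
    by (subst lborel_pair.Fubini') (auto simp: split_beta')
  also have "\<dots> = (\<integral>\<^sup>+v. beta_const a b * (g v * ennreal (v powr (a + b - 1)) * indicator {0<..} v) \<partial>lborel)"
  proof (rule nn_integral_cong)
    fix v :: real
    let ?h = "\<lambda>s. ennreal ((v - s) powr (b - 1)) * indicator {0<..} (v - s)
      * (ennreal (s powr (a - 1)) * indicator {0<..} s)"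
    have "(\<integral>\<^sup>+s. g v * ennreal ((v - s) powr (b - 1)) * indicator {0<..} (v - s)
      * (ennreal (s powr (a - 1)) * indicator {0<..} s) \<partial>lborel) = g v * (\<integral>\<^sup>+s. ?h s \<partial>lborel)"
      by (subst nn_integral_cmult[symmetric]) (auto simp: mult.assoc)
    also have "(\<integral>\<^sup>+s. ?h s \<partial>lborel)
      = beta_const a b * (ennreal (v powr (a + b - 1)) * indicator {0<..} v)"
    proof (cases "0 < v")
      case True
      \<comment> \<open>The substitution s = v z takes a factor v from ds and the powers b - 1 and a
        - 1 of v from the two factors, leaving a beta integral in z.\<close>
      have "(\<integral>\<^sup>+s. ?h s \<partial>lborel) = ennreal v * (\<integral>\<^sup>+z. ?h (v * z) \<partial>lborel)"
        using nn_integral_real_affine[of ?h v 0] True by simp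
      also have "\<dots> = (\<integral>\<^sup>+z. ennreal v * ?h (v * z) \<partial>lborel)"
        by (subst nn_integral_cmult) auto
      also have "\<dots> = (\<integral>\<^sup>+z. ennreal (v powr (a + b - 1)) * (ennreal (z powr (a - 1))
        * ennreal ((1 - z) powr (b - 1)) * indicator {0<..<1} z) \<partial>lborel)"
      proof (rule nn_integral_cong)
        fix z :: real
        show "ennreal v * ?h (v * z) = ennreal (v powr (a + b - 1)) * (ennreal (z powr (a - 1))
          * ennreal ((1 - z) powr (b - 1)) * indicator {0<..<1} z)"
        proof (cases "0 < z \<and> z < 1")
          case z: True
          have "v - v * z = v * (1 - z)" by (simp add: algebra_simps)
          then have "(v - v * z) powr (b - 1) = v powr (b - 1) * (1 - z) powr (b - 1)"
            using True z by (simp only: powr_mult)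
          moreover have "(v * z) powr (a - 1) = v powr (a - 1) * z powr (a - 1)"
            using True z by (simp add: powr_mult)
          ultimately have "v * ((v - v * z) powr (b - 1) * (v * z) powr (a - 1))
            = (v * v powr (b - 1) * v powr (a - 1)) * (z powr (a - 1) * (1 - z) powr (b - 1))"
            by (simp only: mult_ac)
          also have "v * v powr (b - 1) * v powr (a - 1) = v powr 1 * v powr (b - 1) * v powr (a - 1)"
            using True by simp
          also have "\<dots> = v powr (a + b - 1)" unfolding powr_add[symmetric] by (simp add: algebra_simps)
          finally have "ennreal v * (ennreal ((v - v * z) powr (b - 1)) * ennreal ((v * z) powr (a - 1)))
            = ennreal (v powr (a + b - 1)) * (ennreal (z powr (a - 1)) * ennreal ((1 - z) powr (b - 1)))"
            using True by (simp add: ennreal_mult[symmetric])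
          moreover have "0 < v - v * z" "0 < v * z" using True z by auto
          ultimately show ?thesis using z by simp
        next
          case False
          have "v - v * z = v * (1 - z)" by (simp add: algebra_simps)
          with False have "\<not> (0 < v - v * z \<and> 0 < v * z)"
            using True by (simp only: zero_less_mult_iff) auto
          then show ?thesis using False by (auto simp: indicator_def)
        qed
      qed
      also have "\<dots> = ennreal (v powr (a + b - 1)) * beta_const a b"
        unfolding beta_const_def by (rule nn_integral_cmult) auto
      finally show ?thesis using True by (simp add: mult.commute)
    next
      case False
      then have "(\<integral>\<^sup>+s. ?h s \<partial>lborel) = (\<integral>\<^sup>+(s::real). 0 \<partial>lborel)"
        by (intro nn_integral_cong) (auto simp: indicator_def)
      then show ?thesis using False by simp
    qed
    finally show "(\<integral>\<^sup>+s. g v * ennreal ((v - s) powr (b - 1)) * indicator {0<..} (v - s)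
      * (ennreal (s powr (a - 1)) * indicator {0<..} s) \<partial>lborel)
      = beta_const a b * (g v * ennreal (v powr (a + b - 1)) * indicator {0<..} v)"
      by (simp add: mult_ac)
  qed
  also have "\<dots> = beta_const a b * (\<integral>\<^sup>+v. g v * ennreal (v powr (a + b - 1)) * indicator {0<..} v \<partial>lborel)"
    by (rule nn_integral_cmult) auto
  finally show ?thesis .
qed

section \<open>Translation invariance and quadratic forms in several variables\<close>

lemma product_sigma_finite_lborel: "product_sigma_finite (\<lambda>_. lborel :: real measure)"
  by (simp add: product_sigma_finite_def sigma_finite_lborel)

text \<open>A product measure is determined by its values on boxes, and there invariance holds
  coordinate by coordinate. It serves to absorb the shift that completing the square
  produces.\<close>

lemma distr_PiM_lborel_shift:
  fixes c :: "'i \<Rightarrow> real"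
  assumes "finite I"
  shows "distr (PiM I (\<lambda>_. lborel)) (PiM I (\<lambda>_. lborel)) (\<lambda>x. \<lambda>i\<in>I. x i + c i)
    = PiM I (\<lambda>_. lborel)"
proof -
  interpret product_sigma_finite "\<lambda>_::'i. lborel :: real measure"
    by (rule product_sigma_finite_lborel)
  let ?P = "PiM I (\<lambda>_. lborel :: real measure)"
  let ?T = "\<lambda>x. \<lambda>i\<in>I. x i + c i"
  have T [measurable]: "?T \<in> measurable ?P ?P" by measurable
  have shift: "emeasure lborel ((\<lambda>t. t + a) -` A) = emeasure lborel A"
    if [measurable]: "A \<in> sets borel" for a :: real and A
  proof -
    have "emeasure lborel A = emeasure (distr lborel borel ((+) a)) A" by (simp add: lborel_distr_plus)
    also have "\<dots> = emeasure lborel ((+) a -` A \<inter> space lborel)" by (rule emeasure_distr) auto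
    finally show ?thesis by (simp add: add.commute[of _ a])
  qed
  show ?thesis
  proof (rule PiM_eqI[OF assms])
    fix A :: "'i \<Rightarrow> real set" assume A: "\<And>i. i \<in> I \<Longrightarrow> A i \<in> sets lborel"
    have "emeasure (distr ?P ?P ?T) (Pi\<^sub>E I A) = emeasure ?P (?T -` Pi\<^sub>E I A \<inter> space ?P)"
      by (rule emeasure_distr[OF T]) (use A assms in \<open>auto intro!: sets_PiM_I_finite\<close>)
    also have "?T -` Pi\<^sub>E I A \<inter> space ?P = Pi\<^sub>E I (\<lambda>i. (\<lambda>t. t + c i) -` A i)"
      by (auto simp: space_PiM PiE_iff)
    also have "emeasure ?P \<dots> = (\<Prod>i\<in>I. emeasure lborel ((\<lambda>t. t + c i) -` A i))"
    proof (rule emeasure_PiM[OF assms])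
      fix i assume "i \<in> I"
      then have [measurable]: "A i \<in> sets borel" using A by simp
      show "(\<lambda>t. t + c i) -` A i \<in> sets lborel"
        using measurable_sets[of "\<lambda>t. t + c i" borel borel "A i"] by simp
    qed
    also have "\<dots> = (\<Prod>i\<in>I. emeasure lborel (A i))"
      using A by (intro prod.cong refl shift) simp
    finally show "emeasure (distr ?P ?P ?T) (Pi\<^sub>E I A) = (\<Prod>i\<in>I. emeasure lborel (A i))" .
  qed simp
qed

lemma nn_integral_PiM_lborel_shift:
  fixes c :: "'i \<Rightarrow> real"
  assumes "finite I" and [measurable]: "f \<in> borel_measurable (PiM I (\<lambda>_. lborel))"
  shows "(\<integral>\<^sup>+x. f (\<lambda>i\<in>I. x i + c i) \<partial>PiM I (\<lambda>_. lborel)) = (\<integral>\<^sup>+x. f x \<partial>PiM I (\<lambda>_. lborel))"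
proof -
  have "(\<integral>\<^sup>+x. f x \<partial>PiM I (\<lambda>_. lborel))
    = (\<integral>\<^sup>+x. f x \<partial>distr (PiM I (\<lambda>_. lborel)) (PiM I (\<lambda>_. lborel)) (\<lambda>x. \<lambda>i\<in>I. x i + c i))"
    by (simp only: distr_PiM_lborel_shift[OF assms(1)])
  also have "\<dots> = (\<integral>\<^sup>+x. f (\<lambda>i\<in>I. x i + c i) \<partial>PiM I (\<lambda>_. lborel))"
    by (rule nn_integral_distr) measurable
  finally show ?thesis ..
qed

lemma measurable_quad_form [measurable (raw)]:
  assumes "\<And>i. i < n \<Longrightarrow> (\<lambda>\<omega>. f \<omega> i) \<in> borel_measurable M"
  shows "(\<lambda>\<omega>. quad_form n A (f \<omega>)) \<in> borel_measurable M"
  unfolding quad_form_def using assms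
  by (intro borel_measurable_sum borel_measurable_times) auto

text \<open>\<open>K\<close> is chosen before \<open>A\<close> and \<open>g\<close>, so the only
  trace of \<open>A\<close> is the power of its determinant; this is what later separates V from the
  two ratios. The map \<open>e\<close> places the coordinates at arbitrary indices, since the border
  of a matrix lives at the positions (i, n). In the induction the last coordinate is integrated
  last: completing the square splits off one scaled square, and the convolution of powers adds it to
  the form of the leading block.\<close>

lemma nn_integral_quad_form:
  fixes e :: "nat \<Rightarrow> 'i"
  assumes "0 < n" "inj_on e {..<n}"
  shows "\<exists>K. \<forall>A g. pos_def n A \<longrightarrow> g \<in> borel_measurable borel \<longrightarrow>
    (\<integral>\<^sup>+x. g (quad_form n A (\<lambda>i. x (e i))) \<partial>PiM (e ` {..<n}) (\<lambda>_. lborel))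
    = ennreal (Determinant.det A powr (- 1 / 2)) * K
      * (\<integral>\<^sup>+s. g s * ennreal (s powr (real n / 2 - 1)) * indicator {0<..} s \<partial>lborel)"
  using assms
proof (induction n rule: nat_induct_non_zero)
  case 1
  interpret product_sigma_finite "\<lambda>_::'i. lborel :: real measure"
    by (rule product_sigma_finite_lborel)
  have "(\<integral>\<^sup>+x. g (quad_form 1 A (\<lambda>i. x (e i))) \<partial>PiM (e ` {..<1}) (\<lambda>_. lborel))
    = ennreal (Determinant.det A powr (- 1 / 2)) * 1
      * (\<integral>\<^sup>+s. g s * ennreal (s powr (real 1 / 2 - 1)) * indicator {0<..} s \<partial>lborel)"
    if A: "pos_def 1 A" and g [measurable]: "g \<in> borel_measurable borel" for A and g :: "real \<Rightarrow> ennreal"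
  proof -
    have "A \<in> carrier_mat 1 1" using A by (simp add: pos_def_def symmetric_mat_def)
    then have det: "Determinant.det A = A $$ (0, 0)" by (rule det_single)
    have "(\<integral>\<^sup>+x. g (quad_form 1 A (\<lambda>i. x (e i))) \<partial>PiM (e ` {..<1}) (\<lambda>_. lborel))
      = (\<integral>\<^sup>+x. (\<lambda>t. g (A $$ (0, 0) * t\<^sup>2)) (x (e 0)) \<partial>PiM {e 0} (\<lambda>_. lborel))"
      by (simp add: quad_form_def power2_eq_square mult.assoc lessThan_Suc)
    also have "\<dots> = (\<integral>\<^sup>+t. g (A $$ (0, 0) * t\<^sup>2) \<partial>lborel)"
      by (rule product_nn_integral_singleton) measurable
    also have "\<dots> = ennreal (A $$ (0, 0) powr (- 1 / 2))
      * (\<integral>\<^sup>+r. g r * ennreal (r powr (- 1 / 2)) * indicator {0<..} r \<partial>lborel)"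
      using pos_def_imp_det_pos[OF A] by (intro nn_integral_scaled_power2) (simp_all add: det)
    finally show ?thesis by (simp add: det)
  qed
  then show ?case by blast
next
  case (Suc n)
  interpret product_sigma_finite "\<lambda>_::'i. lborel :: real measure"
    by (rule product_sigma_finite_lborel)
  have inj: "inj_on e {..<n}" using Suc.prems by (rule inj_on_subset) auto
  let ?J = "e ` {..<n}"
  have fin: "finite ?J" by simp
  have ins: "e ` {..<Suc n} = insert (e n) ?J" by (simp add: lessThan_Suc)
  have ne: "e i \<noteq> e n" if "i < n" for i using inj_onD[OF Suc.prems, of i n] that by auto
  then have notin: "e n \<notin> ?J" by (metis imageE lessThan_iff)
  obtain K where K: "\<And>A g. pos_def n A \<Longrightarrow> g \<in> borel_measurable borel \<Longrightarrow>
    (\<integral>\<^sup>+x. g (quad_form n A (\<lambda>i. x (e i))) \<partial>PiM ?J (\<lambda>_. lborel))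
    = ennreal (Determinant.det A powr (- 1 / 2)) * K
      * (\<integral>\<^sup>+s. g s * ennreal (s powr (real n / 2 - 1)) * indicator {0<..} s \<partial>lborel)"
    using Suc.IH[OF inj] by blast
  have "(\<integral>\<^sup>+x. g (quad_form (Suc n) A (\<lambda>i. x (e i))) \<partial>PiM (e ` {..<Suc n}) (\<lambda>_. lborel))
    = ennreal (Determinant.det A powr (- 1 / 2)) * (K * beta_const (real n / 2) (1 / 2))
      * (\<integral>\<^sup>+s. g s * ennreal (s powr (real (Suc n) / 2 - 1)) * indicator {0<..} s \<partial>lborel)"
    if pd: "pos_def (Suc n) A" and g [measurable]: "g \<in> borel_measurable borel"
    for A and g :: "real \<Rightarrow> ennreal"
  proof -
    have A: "symmetric_mat (Suc n) A" using pd by (simp add: pos_def_def)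
    define V where "V = leading_block n A"
    have V: "pos_def n V" unfolding V_def by (rule pos_def_leading_block[OF pd])
    obtain c where c: "\<And>i. i < n \<Longrightarrow> (\<Sum>j<n. A $$ (i, j) * c j) = A $$ (i, n)"
      using pos_def_obtain_schur[OF V[unfolded V_def] A] by blast
    define \<sigma> where "\<sigma> = A $$ (n, n) - (\<Sum>i<n. A $$ (i, n) * c i)"
    have det: "Determinant.det A = Determinant.det V * \<sigma>"
      unfolding \<sigma>_def V_def by (rule det_Suc_schur_symmetric[OF A c])
    have \<sigma>: "0 < \<sigma>"
      using pos_def_Suc_iff_schur[OF A c V[unfolded V_def]] pd by (simp add: \<sigma>_def)
    have detV: "0 < Determinant.det V" by (rule pos_def_imp_det_pos[OF V])
    have square: "quad_form (Suc n) A (\<lambda>i. (x(e n := t)) (e i))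
      = quad_form n V (\<lambda>i. x (e i) + t * c i) + \<sigma> * t\<^sup>2" for x t
    proof -
      have "quad_form n V (\<lambda>i. (x(e n := t)) (e i) + (x(e n := t)) (e n) * c i)
        = quad_form n V (\<lambda>i. x (e i) + t * c i)"
        by (rule quad_form_cong) (auto simp: ne)
      then show ?thesis
        using quad_form_Suc_complete_square[OF A c, where x = "\<lambda>i. (x(e n := t)) (e i)"]
        by (simp add: \<sigma>_def V_def)
    qed
    \<comment> \<open>For fixed t the other coordinates are translated by t times c, which does not
      change the integral. The constant \<sigma> t^2 is absorbed into the test function, which is
      why the induction hypothesis is needed for every \<open>g\<close>.\<close>
    have inner: "(\<integral>\<^sup>+x. g (quad_form n V (\<lambda>i. x (e i) + t * c i) + \<sigma> * t\<^sup>2) \<partial>PiM ?J (\<lambda>_. lborel))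
      = ennreal (Determinant.det V powr (- 1 / 2)) * K
      * (\<integral>\<^sup>+s. g (s + \<sigma> * t\<^sup>2) * ennreal (s powr (real n / 2 - 1)) * indicator {0<..} s \<partial>lborel)" for t
    proof -
      \<comment> \<open>The weights \<open>c\<close> are indexed by numbers but the product space by
        the positions \<open>e i\<close>, hence the inverse of \<open>e\<close>.\<close>
      have "(\<integral>\<^sup>+x. g (quad_form n V (\<lambda>i. x (e i) + t * c i) + \<sigma> * t\<^sup>2) \<partial>PiM ?J (\<lambda>_. lborel))
        = (\<integral>\<^sup>+x. g (quad_form n V (\<lambda>i. (\<lambda>j\<in>?J. x j + t * c (the_inv_into {..<n} e j)) (e i)) + \<sigma> * t\<^sup>2)
            \<partial>PiM ?J (\<lambda>_. lborel))"
        by (intro nn_integral_cong arg_cong[where f = g] arg_cong2[where f = "(+)"] refl quad_form_cong)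
          (auto simp: the_inv_into_f_f[OF inj])
      also have "\<dots> = (\<integral>\<^sup>+x. g (quad_form n V (\<lambda>i. x (e i)) + \<sigma> * t\<^sup>2) \<partial>PiM ?J (\<lambda>_. lborel))"
        by (rule nn_integral_PiM_lborel_shift[OF fin,
            of "\<lambda>x. g (quad_form n V (\<lambda>i. x (e i)) + \<sigma> * t\<^sup>2)"]) measurable
      finally show ?thesis using K[OF V, of "\<lambda>s. g (s + \<sigma> * t\<^sup>2)"] by simp
    qed
    have "(\<integral>\<^sup>+x. g (quad_form (Suc n) A (\<lambda>i. x (e i))) \<partial>PiM (e ` {..<Suc n}) (\<lambda>_. lborel))
      = (\<integral>\<^sup>+t. \<integral>\<^sup>+x. g (quad_form (Suc n) A (\<lambda>i. (x(e n := t)) (e i))) \<partial>PiM ?J (\<lambda>_. lborel) \<partial>lborel)"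
      unfolding ins
    proof (rule product_nn_integral_insert_rev[OF fin notin])
      have "e i \<in> insert (e n) ?J" if "i < Suc n" for i using that by (auto simp: less_Suc_eq)
      then show "(\<lambda>x. g (quad_form (Suc n) A (\<lambda>i. x (e i))))
        \<in> borel_measurable (PiM (insert (e n) ?J) (\<lambda>_. lborel))"
        by measurable
    qed
    also have "\<dots> = (\<integral>\<^sup>+t. ennreal (Determinant.det V powr (- 1 / 2)) * K
      * (\<integral>\<^sup>+s. g (s + \<sigma> * t\<^sup>2) * ennreal (s powr (real n / 2 - 1)) * indicator {0<..} s \<partial>lborel) \<partial>lborel)"
      by (simp only: square inner)
    also have "\<dots> = ennreal (Determinant.det V powr (- 1 / 2)) * K * (\<integral>\<^sup>+t. \<integral>\<^sup>+s. g (s + \<sigma> * t\<^sup>2)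
      * ennreal (s powr (real n / 2 - 1)) * indicator {0<..} s \<partial>lborel \<partial>lborel)"
      by (rule nn_integral_cmult) measurable
    also have "(\<integral>\<^sup>+t. \<integral>\<^sup>+s. g (s + \<sigma> * t\<^sup>2)
        * ennreal (s powr (real n / 2 - 1)) * indicator {0<..} s \<partial>lborel \<partial>lborel)
      = (\<integral>\<^sup>+s. \<integral>\<^sup>+t. g (s + \<sigma> * t\<^sup>2)
        * ennreal (s powr (real n / 2 - 1)) * indicator {0<..} s \<partial>lborel \<partial>lborel)"
      by (rule lborel_pair.Fubini') measurable
    also have "\<dots> = (\<integral>\<^sup>+s. ennreal (\<sigma> powr (- 1 / 2)) *
      ((\<integral>\<^sup>+r. g (s + r) * ennreal (r powr (1 / 2 - 1)) * indicator {0<..} r \<partial>lborel)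
        * ennreal (s powr (real n / 2 - 1)) * indicator {0<..} s) \<partial>lborel)"
    proof (rule nn_integral_cong)
      fix s :: real
      have "(\<integral>\<^sup>+t. g (s + \<sigma> * t\<^sup>2) * ennreal (s powr (real n / 2 - 1)) * indicator {0<..} s \<partial>lborel)
        = (\<integral>\<^sup>+t. g (s + \<sigma> * t\<^sup>2) \<partial>lborel) * (ennreal (s powr (real n / 2 - 1)) * indicator {0<..} s)"
        by (subst nn_integral_multc[symmetric]) (auto simp: mult.assoc)
      also have "(\<integral>\<^sup>+t. g (s + \<sigma> * t\<^sup>2) \<partial>lborel) = ennreal (\<sigma> powr (- 1 / 2)) *
        (\<integral>\<^sup>+r. g (s + r) * ennreal (r powr (1 / 2 - 1)) * indicator {0<..} r \<partial>lborel)"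
        using nn_integral_scaled_power2[OF _ \<sigma>, of "\<lambda>r. g (s + r)"] by simp
      finally show "(\<integral>\<^sup>+t. g (s + \<sigma> * t\<^sup>2) * ennreal (s powr (real n / 2 - 1)) * indicator {0<..} s \<partial>lborel)
        = ennreal (\<sigma> powr (- 1 / 2)) *
          ((\<integral>\<^sup>+r. g (s + r) * ennreal (r powr (1 / 2 - 1)) * indicator {0<..} r \<partial>lborel)
            * ennreal (s powr (real n / 2 - 1)) * indicator {0<..} s)"
        by (simp only: mult.assoc)
    qed
    also have "\<dots> = ennreal (\<sigma> powr (- 1 / 2)) * (\<integral>\<^sup>+s.
      (\<integral>\<^sup>+r. g (s + r) * ennreal (r powr (1 / 2 - 1)) * indicator {0<..} r \<partial>lborel)
        * ennreal (s powr (real n / 2 - 1)) * indicator {0<..} s \<partial>lborel)"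
      by (rule nn_integral_cmult) measurable
    \<comment> \<open>The exponents n/2 and 1/2 add up to (n + 1)/2. The convolution constant is the
      factor by which \<open>K\<close> changes; it does not involve \<open>A\<close>.\<close>
    also have "\<dots> = ennreal (\<sigma> powr (- 1 / 2)) * (beta_const (real n / 2) (1 / 2)
      * (\<integral>\<^sup>+v. g v * ennreal (v powr (real n / 2 + 1 / 2 - 1)) * indicator {0<..} v \<partial>lborel))"
      by (simp only: nn_integral_powr_convolution[OF g])
    finally have "(\<integral>\<^sup>+x. g (quad_form (Suc n) A (\<lambda>i. x (e i))) \<partial>PiM (e ` {..<Suc n}) (\<lambda>_. lborel))
      = ennreal (Determinant.det V powr (- 1 / 2)) * K * (ennreal (\<sigma> powr (- 1 / 2))
        * (beta_const (real n / 2) (1 / 2)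
      * (\<integral>\<^sup>+v. g v * ennreal (v powr (real n / 2 + 1 / 2 - 1)) * indicator {0<..} v \<partial>lborel)))" .
    moreover have "ennreal (Determinant.det A powr (- 1 / 2))
      = ennreal (Determinant.det V powr (- 1 / 2)) * ennreal (\<sigma> powr (- 1 / 2))"
      unfolding det using \<sigma> detV by (simp add: powr_mult ennreal_mult)
    moreover have "real (Suc n) / 2 - 1 = real n / 2 + 1 / 2 - 1" by simp
    ultimately show ?thesis by (simp only: mult_ac)
  qed
  then show ?case by blast
qed

section \<open>Lebesgue measure on bordered symmetric matrices\<close>

text \<open>In the last row and the last column the smaller index is the one below \<open>n\<close>,
  so \<open>u (min i j)\<close> fills both.\<close>

definition bordered_mat :: "nat \<Rightarrow> real mat \<Rightarrow> (nat \<Rightarrow> real) \<Rightarrow> real \<Rightarrow> real mat" where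
  "bordered_mat n V u w = mat (Suc n) (Suc n) (\<lambda>(i, j).
     if i < n \<and> j < n then V $$ (i, j) else if i = n \<and> j = n then w else u (min i j))"

lemma bordered_mat_carrier [simp]: "bordered_mat n V u w \<in> carrier_mat (Suc n) (Suc n)"
  by (simp add: bordered_mat_def)

lemma leading_block_bordered_mat:
  "V \<in> carrier_mat n n \<Longrightarrow> leading_block n (bordered_mat n V u w) = V"
  by (intro eq_matI) (auto simp: bordered_mat_def)

lemma symmetric_bordered_mat:
  assumes "symmetric_mat n V"
  shows "symmetric_mat (Suc n) (bordered_mat n V u w)"
  using assms
  by (intro symmetric_matI) (auto simp: bordered_mat_def min.commute symmetric_mat_entry)

text \<open>The identity has no off-diagonal entries, so the complement is again a bordered matrix
  with the border negated, a sign that quadratic forms do not see. Everything proved for U thus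
  applies to I - U.\<close>

lemma one_minus_bordered_mat:
  assumes "V \<in> carrier_mat n n"
  shows "1\<^sub>m (Suc n) - bordered_mat n V u w = bordered_mat n (1\<^sub>m n - V) (\<lambda>i. - u i) (1 - w)"
  using assms by (intro eq_matI) (auto simp: bordered_mat_def)

text \<open>With \<open>c\<close> equal to \<open>B\<close> applied to \<open>u\<close>, the product
  of the border with \<open>c\<close> is the quadratic form of the inverse \<open>B\<close> at
  \<open>u\<close>.\<close>

lemma bordered_mat_schur:
  assumes V: "pos_def n V" and B: "V * B = 1\<^sub>m n" "B \<in> carrier_mat n n"
  shows "Determinant.det (bordered_mat n V u w) = Determinant.det V * (w - quad_form n B u)"
    and "pos_def (Suc n) (bordered_mat n V u w) \<longleftrightarrow> 0 < w - quad_form n B u"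
proof -
  let ?U = "bordered_mat n V u w"
  have cV: "V \<in> carrier_mat n n" and sV: "symmetric_mat n V"
    using V by (auto simp: pos_def_def symmetric_mat_def)
  note LB = leading_block_bordered_mat[OF cV, of u w]
  have U: "symmetric_mat (Suc n) ?U" by (rule symmetric_bordered_mat[OF sV])
  define c where "c i = (\<Sum>k<n. B $$ (i, k) * u k)" for i
  have VB: "(\<Sum>j<n. V $$ (i, j) * B $$ (j, k)) = (if i = k then 1 else 0)" if "i < n" "k < n" for i k
  proof -
    have "(V * B) $$ (i, k) = (\<Sum>j<n. V $$ (i, j) * B $$ (j, k))"
      using that cV B(2) by (auto simp: scalar_prod_def atLeast0LessThan intro!: sum.cong)
    then show ?thesis using that B(1) by simp
  qed
  have c: "(\<Sum>j<n. ?U $$ (i, j) * c j) = ?U $$ (i, n)" if i: "i < n" for i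
  proof -
    have "(\<Sum>j<n. ?U $$ (i, j) * c j) = (\<Sum>j<n. \<Sum>k<n. V $$ (i, j) * B $$ (j, k) * u k)"
      using i unfolding c_def sum_distrib_left
      by (intro sum.cong refl) (auto simp: bordered_mat_def mult.assoc)
    also have "\<dots> = (\<Sum>k<n. (\<Sum>j<n. V $$ (i, j) * B $$ (j, k)) * u k)"
      unfolding sum_distrib_right by (rule sum.swap)
    also have "\<dots> = (\<Sum>k<n. (if i = k then 1 else 0) * u k)"
      using VB[OF i] by (intro sum.cong refl) auto
    also have "\<dots> = u i" using i by (simp add: if_distrib[of "\<lambda>x. x * _"] sum.delta' cong: if_cong)
    finally show ?thesis using i by (simp add: bordered_mat_def)
  qed
  have "(\<Sum>i<n. ?U $$ (i, n) * c i) = quad_form n B u"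
    unfolding quad_form_def c_def sum_distrib_left
    by (intro sum.cong refl) (auto simp: bordered_mat_def)
  moreover have "?U $$ (n, n) = w" by (simp add: bordered_mat_def)
  ultimately show "Determinant.det ?U = Determinant.det V * (w - quad_form n B u)"
    "pos_def (Suc n) ?U \<longleftrightarrow> 0 < w - quad_form n B u"
    using det_Suc_schur_symmetric[OF U c] pos_def_Suc_iff_schur[OF U c] V unfolding LB by simp_all
qed

section \<open>Measurability on the space of symmetric matrices\<close>

lemma measurable_sym_of_entries [measurable]:
  "sym_of_entries p \<in> measurable (PiM (upper_indices p) (\<lambda>_. lborel)) (lebesgue_sym p)"
  unfolding lebesgue_sym_def by (rule measurable_embed_measure2'[OF inj_on_sym_of_entries])

lemma measurable_lebesgue_symI:
  assumes "(\<lambda>x. F (sym_of_entries p x)) \<in> measurable (PiM (upper_indices p) (\<lambda>_. lborel)) N"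
  shows "F \<in> measurable (lebesgue_sym p) N"
  unfolding lebesgue_sym_def by (rule measurable_embed_measure1) (rule assms)

lemma nn_integral_lebesgue_sym:
  assumes "F \<in> borel_measurable (lebesgue_sym p)"
  shows "(\<integral>\<^sup>+A. F A \<partial>lebesgue_sym p)
    = (\<integral>\<^sup>+x. F (sym_of_entries p x) \<partial>PiM (upper_indices p) (\<lambda>_. lborel))"
  using assms unfolding lebesgue_sym_def
  by (rule nn_integral_embed_measure'[OF inj_on_sym_of_entries])

lemma sym_of_entries_carrier [simp]: "sym_of_entries p x \<in> carrier_mat p p"
  by (simp add: sym_of_entries_def)

lemma symmetric_sym_of_entries: "symmetric_mat p (sym_of_entries p x)"
  by (intro symmetric_matI) (auto simp: sym_of_entries_def min.commute max.commute)

lemma measurable_entry_lebesgue_sym: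
  assumes "i < p" "j < p"
  shows "(\<lambda>A. A $$ (i, j)) \<in> borel_measurable (lebesgue_sym p)"
proof (rule measurable_lebesgue_symI)
  have [measurable]: "(min i j, max i j) \<in> upper_indices p"
    using assms by (auto simp: upper_indices_def)
  show "(\<lambda>x. sym_of_entries p x $$ (i, j)) \<in> borel_measurable (PiM (upper_indices p) (\<lambda>_. lborel))"
    using assms by (simp add: sym_of_entries_def)
qed

text \<open>By the Leibniz formula the determinant is a polynomial in the entries.\<close>

lemma measurable_det:
  fixes F :: "'a \<Rightarrow> real mat"
  assumes F: "\<And>\<omega>. \<omega> \<in> space M \<Longrightarrow> F \<omega> \<in> carrier_mat n n"
    and "\<And>i j. i < n \<Longrightarrow> j < n \<Longrightarrow> (\<lambda>\<omega>. F \<omega> $$ (i, j)) \<in> borel_measurable M"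
  shows "(\<lambda>\<omega>. Determinant.det (F \<omega>)) \<in> borel_measurable M"
proof -
  have "(\<lambda>\<omega>. \<Sum>\<pi> \<in> {\<pi>. \<pi> permutes {0..<n}}. signof \<pi> * (\<Prod>i = 0..<n. F \<omega> $$ (i, \<pi> i)))
    \<in> borel_measurable M"
  proof (intro borel_measurable_sum borel_measurable_times borel_measurable_prod)
    fix \<pi> i assume "\<pi> \<in> {\<pi>. \<pi> permutes {0..<n}}" "i \<in> {0..<n}"
    then have "i < n" "\<pi> i < n" using permutes_in_image[of \<pi> "{0..<n}" i] by auto
    then show "(\<lambda>\<omega>. F \<omega> $$ (i, \<pi> i)) \<in> borel_measurable M" by (rule assms)
  qed simp
  then show ?thesis
    by (rule measurable_cong[THEN iffD2, rotated]) (simp add: det_def'[OF F])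
qed

lemma measurable_det_lebesgue_sym [measurable]: "Determinant.det \<in> borel_measurable (lebesgue_sym p)"
  by (rule measurable_det[where F = "\<lambda>A. A", of _ p])
    (auto simp: space_lebesgue_sym symmetric_mat_def intro: measurable_entry_lebesgue_sym)

lemma measurable_leading_block:
  assumes "k \<le> p"
  shows "leading_block k \<in> measurable (lebesgue_sym p) (lebesgue_sym k)"
proof (rule measurable_lebesgue_symI)
  have sub: "upper_indices k \<subseteq> upper_indices p" using assms by (auto simp: upper_indices_def)
  have "leading_block k (sym_of_entries p x) = sym_of_entries k (restrict x (upper_indices k))" for x
    using assms by (intro eq_matI) (auto simp: sym_of_entries_def upper_indices_def)
  moreover have "(\<lambda>x. sym_of_entries k (restrict x (upper_indices k)))
    \<in> measurable (PiM (upper_indices p) (\<lambda>_. lborel)) (lebesgue_sym k)"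
    using measurable_restrict_subset[OF sub] by (rule measurable_compose) measurable
  ultimately show "(\<lambda>x. leading_block k (sym_of_entries p x))
    \<in> measurable (PiM (upper_indices p) (\<lambda>_. lborel)) (lebesgue_sym k)" by simp
qed

text \<open>In coordinates the map is affine: x goes to 1 - x at diagonal positions and to - x
  elsewhere.\<close>

lemma measurable_one_minus_lebesgue_sym:
  "(\<lambda>A. 1\<^sub>m p - A) \<in> measurable (lebesgue_sym p) (lebesgue_sym p)"
proof (rule measurable_lebesgue_symI)
  let ?T = "\<lambda>x. \<lambda>k\<in>upper_indices p. (if fst k = snd k then 1 else 0) - x k :: real"
  have "1\<^sub>m p - sym_of_entries p x = sym_of_entries p (?T x)" for x
    by (intro eq_matI) (auto simp: sym_of_entries_def upper_indices_def min_def max_def)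
  moreover have "(\<lambda>x. sym_of_entries p (?T x))
    \<in> measurable (PiM (upper_indices p) (\<lambda>_. lborel)) (lebesgue_sym p)" by measurable
  ultimately show "(\<lambda>x. 1\<^sub>m p - sym_of_entries p x)
    \<in> measurable (PiM (upper_indices p) (\<lambda>_. lborel)) (lebesgue_sym p)" by simp
qed

text \<open>The definition quantifies over uncountably many vectors. Sylvester's criterion replaces
  this by finitely many determinant inequalities on leading blocks.\<close>

lemma measurable_pos_def: "Measurable.pred (lebesgue_sym p) (pos_def p)"
proof (induction p)
  case 0
  have eq: "pos_def 0 A \<longleftrightarrow> True" if "A \<in> space (lebesgue_sym 0)" for A
    using that by (auto simp: pos_def_def space_lebesgue_sym)
  have "Measurable.pred (lebesgue_sym 0) (\<lambda>_. True)" by simp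
  then show ?case by (rule measurable_cong[THEN iffD2, rotated]) (rule eq)
next
  case (Suc p)
  have [measurable]: "Measurable.pred (lebesgue_sym (Suc p)) (\<lambda>A. pos_def p (leading_block p A))"
    by (rule measurable_compose[OF measurable_leading_block Suc]) simp
  have eq: "pos_def (Suc p) A \<longleftrightarrow> pos_def p (leading_block p A) \<and> 0 < Determinant.det A"
    if "A \<in> space (lebesgue_sym (Suc p))" for A
    using that by (intro pos_def_Suc_iff) (simp add: space_lebesgue_sym)
  have "Measurable.pred (lebesgue_sym (Suc p))
    (\<lambda>A. pos_def p (leading_block p A) \<and> 0 < Determinant.det A)" by measurable
  then show ?case by (rule measurable_cong[THEN iffD2, rotated]) (rule eq)
qed

section \<open>The matrix beta weight and integration over block, border and corner\<close>

definition beta_weight :: "nat \<Rightarrow> real \<Rightarrow> real \<Rightarrow> real mat \<Rightarrow> real" where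
  "beta_weight p \<gamma> \<delta> A = (if loewner_less p (0\<^sub>m p p) A \<and> loewner_less p A (1\<^sub>m p)
     then Determinant.det A powr (\<gamma> - (real p + 1) / 2) *
          Determinant.det (1\<^sub>m p - A) powr (\<delta> - (real p + 1) / 2)
     else 0)"

lemma beta_weight_symmetric:
  assumes "symmetric_mat p A"
  shows "beta_weight p \<gamma> \<delta> A = (if pos_def p A \<and> pos_def p (1\<^sub>m p - A)
     then Determinant.det A powr (\<gamma> - (real p + 1) / 2) *
          Determinant.det (1\<^sub>m p - A) powr (\<delta> - (real p + 1) / 2)
     else 0)"
proof -
  have "A - 0\<^sub>m p p = A" using assms by (auto simp: symmetric_mat_def intro!: eq_matI)
  then show ?thesis by (simp add: beta_weight_def loewner_less_def)
qed

lemma measurable_beta_weight [measurable]: "beta_weight p \<gamma> \<delta> \<in> borel_measurable (lebesgue_sym p)"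
proof -
  note [measurable] = measurable_pos_def[of p]
    measurable_compose[OF measurable_one_minus_lebesgue_sym measurable_pos_def, of p]
    measurable_compose[OF measurable_one_minus_lebesgue_sym measurable_det_lebesgue_sym, of p]
  have "(\<lambda>A. if pos_def p A \<and> pos_def p (1\<^sub>m p - A)
     then Determinant.det A powr (\<gamma> - (real p + 1) / 2) *
          Determinant.det (1\<^sub>m p - A) powr (\<delta> - (real p + 1) / 2)
     else 0) \<in> borel_measurable (lebesgue_sym p)" by measurable
  then show ?thesis
    by (rule measurable_cong[THEN iffD2, rotated]) (simp add: beta_weight_symmetric space_lebesgue_sym)
qed

lemma finite_upper_indices: "finite (upper_indices p)"
  by (rule finite_subset[of _ "{..<p} \<times> {..<p}"]) (auto simp: upper_indices_def)

text \<open>The index set splits into the positions of the block, of the border and of the corner.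
  The corner is integrated innermost because, with block and border fixed, a translation turns it
  into a determinant ratio.\<close>

lemma nn_integral_lebesgue_sym_Suc:
  assumes F [measurable]: "F \<in> borel_measurable (lebesgue_sym (Suc n))"
  shows "(\<integral>\<^sup>+A. F A \<partial>lebesgue_sym (Suc n))
    = (\<integral>\<^sup>+x. \<integral>\<^sup>+y. \<integral>\<^sup>+w. F (bordered_mat n (sym_of_entries n x) (\<lambda>i. y (i, n)) w) \<partial>lborel
        \<partial>PiM ((\<lambda>i. (i, n)) ` {..<n}) (\<lambda>_. lborel) \<partial>PiM (upper_indices n) (\<lambda>_. lborel))"
proof -
  interpret product_sigma_finite "\<lambda>_::nat \<times> nat. lborel :: real measure"
    by (rule product_sigma_finite_lborel)
  let ?J = "(\<lambda>i. (i, n)) ` {..<n}"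
  let ?I = "upper_indices n"
  let ?J' = "insert (n, n) ?J"
  have eq: "upper_indices (Suc n) = ?I \<union> ?J'"
    by (auto simp: upper_indices_def less_Suc_eq image_iff le_less)
  have disj: "?I \<inter> ?J' = {}" by (auto simp: upper_indices_def)
  have notin: "(n, n) \<notin> ?J" by auto
  have finJ: "finite ?J" "finite ?J'" by auto
  let ?f = "\<lambda>x. F (sym_of_entries (Suc n) x)"
  have f [measurable]: "?f \<in> borel_measurable (PiM (?I \<union> ?J') (\<lambda>_. lborel))"
    unfolding eq[symmetric] by measurable
  have merged: "sym_of_entries (Suc n) (merge ?I ?J' (x, y((n, n) := w)))
    = bordered_mat n (sym_of_entries n x) (\<lambda>i. y (i, n)) w" (is "?l = ?r") for x y w
  proof (rule eq_matI)
    fix i j assume "i < dim_row ?r" "j < dim_col ?r"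
    then have ij: "i < Suc n" "j < Suc n" by (auto simp: bordered_mat_def)
    then consider "i < n" "j < n" | "i = n" "j = n" | "i = n" "j < n" | "i < n" "j = n"
      by (auto simp: less_Suc_eq)
    then show "?l $$ (i, j) = ?r $$ (i, j)"
      by cases (auto simp: sym_of_entries_def bordered_mat_def merge_def upper_indices_def
          min_def max_def)
  qed (auto simp: sym_of_entries_def bordered_mat_def)
  have "(\<integral>\<^sup>+A. F A \<partial>lebesgue_sym (Suc n)) = (\<integral>\<^sup>+x. ?f x \<partial>PiM (?I \<union> ?J') (\<lambda>_. lborel))"
    using nn_integral_lebesgue_sym[OF F] unfolding eq .
  also have "\<dots> = (\<integral>\<^sup>+x. \<integral>\<^sup>+z. ?f (merge ?I ?J' (x, z)) \<partial>PiM ?J' (\<lambda>_. lborel) \<partial>PiM ?I (\<lambda>_. lborel))"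
    by (rule product_nn_integral_fold[OF disj finite_upper_indices finJ(2) f])
  also have "\<dots> = (\<integral>\<^sup>+x. \<integral>\<^sup>+y. \<integral>\<^sup>+w. ?f (merge ?I ?J' (x, y((n, n) := w))) \<partial>lborel
    \<partial>PiM ?J (\<lambda>_. lborel) \<partial>PiM ?I (\<lambda>_. lborel))"
  proof (rule nn_integral_cong)
    fix x assume x [measurable]: "x \<in> space (PiM ?I (\<lambda>_. lborel :: real measure))"
    have "(\<lambda>z. merge ?I ?J' (x, z)) \<in> measurable (PiM ?J' (\<lambda>_. lborel)) (PiM (?I \<union> ?J') (\<lambda>_. lborel))"
      by measurable
    from measurable_compose[OF this f]
    show "(\<integral>\<^sup>+z. ?f (merge ?I ?J' (x, z)) \<partial>PiM ?J' (\<lambda>_. lborel))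
      = (\<integral>\<^sup>+y. \<integral>\<^sup>+w. ?f (merge ?I ?J' (x, y((n, n) := w))) \<partial>lborel \<partial>PiM ?J (\<lambda>_. lborel))"
      by (rule product_nn_integral_insert[OF finJ(1) notin])
  qed
  finally show ?thesis by (simp only: merged)
qed

section \<open>Disintegration of the matrix beta weight\<close>

text \<open>With W = I - V, the product V (B + C) W equals W + V = I when B and C are the inverses
  of V and W.\<close>

lemma det_add_inverses:
  assumes V: "V \<in> carrier_mat n n" and B: "B \<in> carrier_mat n n" and C: "C \<in> carrier_mat n n"
    and VB: "V * B = 1\<^sub>m n" and CV: "C * (1\<^sub>m n - V) = (1\<^sub>m n :: real mat)"
  shows "Determinant.det V * Determinant.det (B + C) * Determinant.det (1\<^sub>m n - V) = 1"
proof -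
  have W: "1\<^sub>m n - V \<in> carrier_mat n n" using V by auto
  have "V * (B + C) * (1\<^sub>m n - V) = (1\<^sub>m n + V * C) * (1\<^sub>m n - V)"
    by (simp only: mult_add_distrib_mat[OF V B C] VB)
  also have "\<dots> = 1\<^sub>m n * (1\<^sub>m n - V) + V * C * (1\<^sub>m n - V)"
    by (rule add_mult_distrib_mat) (use V C W in auto)
  also have "V * C * (1\<^sub>m n - V) = V * (C * (1\<^sub>m n - V))"
    by (rule assoc_mult_mat[OF V C W])
  also have "1\<^sub>m n * (1\<^sub>m n - V) + V * (C * (1\<^sub>m n - V)) = 1\<^sub>m n"
    unfolding CV using V by (intro eq_matI) auto
  finally have "Determinant.det (V * (B + C) * (1\<^sub>m n - V)) = 1" by simp
  then show ?thesis using det_mult[of "V * (B + C)" n "1\<^sub>m n - V"] det_mult[of V n "B + C"] V B C W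
    by auto
qed

text \<open>The unnormalised Dirichlet density with parameters \<gamma> - n/2, \<delta> - n/2 and
  n/2; the first two exponents are those of the matrix weight of size n + 1.\<close>

definition simplex_weight :: "nat \<Rightarrow> real \<Rightarrow> real \<Rightarrow> real \<Rightarrow> real \<Rightarrow> real" where
  "simplex_weight n \<gamma> \<delta> a b = (if 0 < a \<and> 0 < b \<and> a + b < 1
     then a powr (\<gamma> - (real (Suc n) + 1) / 2) * b powr (\<delta> - (real (Suc n) + 1) / 2)
       * (1 - a - b) powr (real n / 2 - 1) else 0)"

lemma measurable_simplex_weight [measurable (raw)]:
  assumes [measurable]: "f \<in> borel_measurable M" "g \<in> borel_measurable M"
  shows "(\<lambda>x. simplex_weight n \<gamma> \<delta> (f x) (g x)) \<in> borel_measurable M"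
  unfolding simplex_weight_def by measurable

text \<open>The integral over one fibre, that is, over all border entries for a fixed V. The
  dependence on V factors out as the weight of size n because \<open>K\<close> comes from
  \<open>nn_integral_quad_form\<close> and is the same for every V.\<close>

lemma nn_integral_bordered_mat:
  fixes \<gamma> \<delta> :: real
  assumes n: "0 < n"
  shows "\<exists>K. \<forall>V h. pos_def n V \<longrightarrow> pos_def n (1\<^sub>m n - V) \<longrightarrow> h \<in> borel_measurable (borel \<Otimes>\<^sub>M borel) \<longrightarrow>
    (\<integral>\<^sup>+y. \<integral>\<^sup>+w. ennreal (beta_weight (Suc n) \<gamma> \<delta> (bordered_mat n V (\<lambda>i. y (i, n)) w))
        * h (Determinant.det (bordered_mat n V (\<lambda>i. y (i, n)) w) / Determinant.det V,
             Determinant.det (1\<^sub>m (Suc n) - bordered_mat n V (\<lambda>i. y (i, n)) w)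
               / Determinant.det (1\<^sub>m n - V)) \<partial>lborel \<partial>PiM ((\<lambda>i. (i, n)) ` {..<n}) (\<lambda>_. lborel))
    = ennreal (beta_weight n \<gamma> \<delta> V)
      * (K * (\<integral>\<^sup>+a. \<integral>\<^sup>+b. ennreal (simplex_weight n \<gamma> \<delta> a b) * h (a, b) \<partial>lborel \<partial>lborel))"
proof -
  define J where "J = (\<lambda>i. (i, n)) ` {..<n}"
  interpret product_sigma_finite "\<lambda>_::nat \<times> nat. lborel :: real measure"
    by (rule product_sigma_finite_lborel)
  have "finite J" by (simp add: J_def)
  then have sfJ: "sigma_finite_measure (PiM J (\<lambda>_. lborel :: real measure))" by (rule sigma_finite)
  then interpret J: pair_sigma_finite "PiM J (\<lambda>_. lborel :: real measure)" "lborel :: real measure"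
    by (intro pair_sigma_finite.intro sigma_finite_lborel)
  have J: "(i, n) \<in> J" if "i < n" for i using that by (simp add: J_def)
  have "inj_on (\<lambda>i. (i, n)) {..<n}" by (auto simp: inj_on_def)
  from nn_integral_quad_form[OF n this] obtain K where K:
    "\<And>A g. pos_def n A \<Longrightarrow> g \<in> borel_measurable borel \<Longrightarrow>
    (\<integral>\<^sup>+x. g (quad_form n A (\<lambda>i. x (i, n))) \<partial>PiM J (\<lambda>_. lborel))
    = ennreal (Determinant.det A powr (- 1 / 2)) * K
      * (\<integral>\<^sup>+s. g s * ennreal (s powr (real n / 2 - 1)) * indicator {0<..} s \<partial>lborel)"
    unfolding J_def by blast
  define \<alpha> \<beta> where "\<alpha> = \<gamma> - (real (Suc n) + 1) / 2" and "\<beta> = \<delta> - (real (Suc n) + 1) / 2"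
  have "(\<integral>\<^sup>+y. \<integral>\<^sup>+w. ennreal (beta_weight (Suc n) \<gamma> \<delta> (bordered_mat n V (\<lambda>i. y (i, n)) w))
        * h (Determinant.det (bordered_mat n V (\<lambda>i. y (i, n)) w) / Determinant.det V,
             Determinant.det (1\<^sub>m (Suc n) - bordered_mat n V (\<lambda>i. y (i, n)) w)
               / Determinant.det (1\<^sub>m n - V)) \<partial>lborel \<partial>PiM J (\<lambda>_. lborel))
    = ennreal (beta_weight n \<gamma> \<delta> V)
      * (K * (\<integral>\<^sup>+a. \<integral>\<^sup>+b. ennreal (simplex_weight n \<gamma> \<delta> a b) * h (a, b) \<partial>lborel \<partial>lborel))"
    if V: "pos_def n V" and W: "pos_def n (1\<^sub>m n - V)"
      and h [measurable]: "h \<in> borel_measurable (borel \<Otimes>\<^sub>M borel)" for V and h :: "real \<times> real \<Rightarrow> ennreal"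
  proof -
    have sV: "symmetric_mat n V" and cV: "V \<in> carrier_mat n n"
      using V by (auto simp: pos_def_def symmetric_mat_def)
    define dV dW where "dV = Determinant.det V" and "dW = Determinant.det (1\<^sub>m n - V)"
    have d: "0 < dV" "0 < dW"
      unfolding dV_def dW_def using pos_def_imp_det_pos[OF V] pos_def_imp_det_pos[OF W] .
    obtain B where B: "pos_def n B" "V * B = 1\<^sub>m n" using pos_def_obtain_inverse[OF V] by blast
    obtain C where C: "pos_def n C" "(1\<^sub>m n - V) * C = 1\<^sub>m n" "C * (1\<^sub>m n - V) = 1\<^sub>m n"
      using pos_def_obtain_inverse[OF W] by blast
    have cB: "B \<in> carrier_mat n n" and cC: "C \<in> carrier_mat n n"
      using B C by (auto simp: pos_def_def symmetric_mat_def)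
    define A where "A = B + C"
    have A: "pos_def n A" unfolding A_def by (rule pos_def_add[OF B(1) C(1)])
    have quad_A: "quad_form n A u = quad_form n B u + quad_form n C u" for u
      using cB cC unfolding A_def quad_form_def sum.distrib[symmetric]
      by (intro sum.cong) (auto simp: algebra_simps)
    have "dV * Determinant.det A * dW = 1"
      unfolding dV_def dW_def A_def by (rule det_add_inverses[OF cV cB cC B(2) C(3)])
    then have "Determinant.det A = inverse (dV * dW)" using d by (simp add: field_simps)
    then have det_A: "Determinant.det A powr (- 1 / 2) = dV powr (1 / 2) * dW powr (1 / 2)"
      using d by (simp add: powr_minus_divide inverse_powr powr_mult powr_minus[symmetric])
    \<comment> \<open>The weight in terms of the two Schur complements; the two conditions are what
      0 < U < I amounts to once 0 < V < I is known.\<close>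
    define G where "G a b = (if 0 < a \<and> 0 < b then ennreal (a powr \<alpha> * b powr \<beta>) * h (a, b) else 0)"
      for a b
    have G [measurable]: "(\<lambda>x. G (f x) (g x)) \<in> borel_measurable M"
      if [measurable]: "f \<in> borel_measurable M" "g \<in> borel_measurable M" for f g and M :: "'z measure"
      unfolding G_def by measurable
    have pt: "ennreal (beta_weight (Suc n) \<gamma> \<delta> (bordered_mat n V u w))
        * h (Determinant.det (bordered_mat n V u w) / Determinant.det V,
             Determinant.det (1\<^sub>m (Suc n) - bordered_mat n V u w) / Determinant.det (1\<^sub>m n - V))
      = ennreal (dV powr \<alpha> * dW powr \<beta>) * G (w - quad_form n B u) (1 - w - quad_form n C u)" for u w
    proof -
      let ?U = "bordered_mat n V u w"
      let ?a = "w - quad_form n B u" and ?b = "1 - w - quad_form n C u"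
      have neg: "quad_form n C (\<lambda>i. - u i) = quad_form n C u" by (simp add: quad_form_def)
      have 1: "Determinant.det ?U = dV * ?a" "pos_def (Suc n) ?U \<longleftrightarrow> 0 < ?a"
        using bordered_mat_schur[OF V B(2) cB, of u w] by (simp_all add: dV_def)
      have 2: "Determinant.det (1\<^sub>m (Suc n) - ?U) = dW * ?b" "pos_def (Suc n) (1\<^sub>m (Suc n) - ?U) \<longleftrightarrow> 0 < ?b"
        using bordered_mat_schur[OF W C(2) cC, of "\<lambda>i. - u i" "1 - w"]
        by (simp_all add: dW_def one_minus_bordered_mat[OF cV] neg)
      have bw: "beta_weight (Suc n) \<gamma> \<delta> ?U
        = (if 0 < ?a \<and> 0 < ?b then (dV * ?a) powr \<alpha> * (dW * ?b) powr \<beta> else 0)"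
        unfolding beta_weight_symmetric[OF symmetric_bordered_mat[OF sV]] 1 2 \<alpha>_def \<beta>_def ..
      have "Determinant.det ?U / Determinant.det V = ?a"
        "Determinant.det (1\<^sub>m (Suc n) - ?U) / Determinant.det (1\<^sub>m n - V) = ?b"
        unfolding 1 2 dV_def[symmetric] dW_def[symmetric] using d by simp_all
      note 3 = this
      show ?thesis
      proof (cases "0 < ?a \<and> 0 < ?b")
        case True
        then have "(dV * ?a) powr \<alpha> * (dW * ?b) powr \<beta> = (dV powr \<alpha> * dW powr \<beta>) * (?a powr \<alpha> * ?b powr \<beta>)"
          using d by (simp only: powr_mult less_imp_le mult_ac)
        then have "ennreal ((dV * ?a) powr \<alpha> * (dW * ?b) powr \<beta>)
          = ennreal (dV powr \<alpha> * dW powr \<beta>) * ennreal (?a powr \<alpha> * ?b powr \<beta>)"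
          by (simp only: ennreal_mult mult_nonneg_nonneg powr_ge_zero)
        then show ?thesis unfolding bw 3 G_def using True by (simp only: if_True simp_thms mult.assoc)
      next
        case False
        then show ?thesis unfolding bw 3 G_def by (simp only: if_False if_True simp_thms ennreal_0 mult_zero_left mult_zero_right)
      qed
    qed
    have "(\<integral>\<^sup>+y. \<integral>\<^sup>+w. ennreal (beta_weight (Suc n) \<gamma> \<delta> (bordered_mat n V (\<lambda>i. y (i, n)) w))
        * h (Determinant.det (bordered_mat n V (\<lambda>i. y (i, n)) w) / Determinant.det V,
             Determinant.det (1\<^sub>m (Suc n) - bordered_mat n V (\<lambda>i. y (i, n)) w)
               / Determinant.det (1\<^sub>m n - V)) \<partial>lborel \<partial>PiM J (\<lambda>_. lborel))
      = (\<integral>\<^sup>+y. \<integral>\<^sup>+w. ennreal (dV powr \<alpha> * dW powr \<beta>) * G (w - quad_form n B (\<lambda>i. y (i, n)))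
          (1 - w - quad_form n C (\<lambda>i. y (i, n))) \<partial>lborel \<partial>PiM J (\<lambda>_. lborel))"
      by (simp only: pt)
    \<comment> \<open>Translating w by the form of B makes a the new variable. The second Schur
      complement then becomes 1 - a minus the forms of B and C, which together are the form of
      A.\<close>
    also have "\<dots> = (\<integral>\<^sup>+y. ennreal (dV powr \<alpha> * dW powr \<beta>) * (\<integral>\<^sup>+a. G a
          (1 - a - quad_form n A (\<lambda>i. y (i, n))) \<partial>lborel) \<partial>PiM J (\<lambda>_. lborel))"
    proof (rule nn_integral_cong)
      fix y :: "nat \<times> nat \<Rightarrow> real"
      let ?f = "\<lambda>w. G (w - quad_form n B (\<lambda>i. y (i, n))) (1 - w - quad_form n C (\<lambda>i. y (i, n)))"
      have "(\<integral>\<^sup>+w. ?f w \<partial>lborel) = (\<integral>\<^sup>+a. ?f (a + quad_form n B (\<lambda>i. y (i, n))) \<partial>lborel)"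
        by (rule nn_integral_lborel_shift[symmetric]) measurable
      also have "\<dots> = (\<integral>\<^sup>+a. G a (1 - a - quad_form n A (\<lambda>i. y (i, n))) \<partial>lborel)"
        by (intro nn_integral_cong) (simp add: quad_A algebra_simps)
      finally show "(\<integral>\<^sup>+w. ennreal (dV powr \<alpha> * dW powr \<beta>) * ?f w \<partial>lborel)
        = ennreal (dV powr \<alpha> * dW powr \<beta>) * (\<integral>\<^sup>+a. G a (1 - a - quad_form n A (\<lambda>i. y (i, n))) \<partial>lborel)"
        by (subst nn_integral_cmult) auto
    qed
    also have "\<dots> = ennreal (dV powr \<alpha> * dW powr \<beta>) * (\<integral>\<^sup>+y. \<integral>\<^sup>+a. G a
          (1 - a - quad_form n A (\<lambda>i. y (i, n))) \<partial>lborel \<partial>PiM J (\<lambda>_. lborel))"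
      by (rule nn_integral_cmult) (use J in measurable)
    also have "(\<integral>\<^sup>+y. \<integral>\<^sup>+a. G a (1 - a - quad_form n A (\<lambda>i. y (i, n))) \<partial>lborel \<partial>PiM J (\<lambda>_. lborel))
      = (\<integral>\<^sup>+a. \<integral>\<^sup>+y. G a (1 - a - quad_form n A (\<lambda>i. y (i, n))) \<partial>PiM J (\<lambda>_. lborel) \<partial>lborel)"
      by (rule J.Fubini'[symmetric]) (use J in measurable)
    also have "\<dots> = (\<integral>\<^sup>+a. ennreal (Determinant.det A powr (- 1 / 2)) * K
      * (\<integral>\<^sup>+b. ennreal (simplex_weight n \<gamma> \<delta> a b) * h (a, b) \<partial>lborel) \<partial>lborel)"
    proof (rule nn_integral_cong)
      fix a :: real
      \<comment> \<open>The variable s is the value of the form of A. Reflecting it to b = 1 - a - s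
        turns the power of s into the third Dirichlet factor and s > 0 into a + b < 1.\<close>
      let ?f = "\<lambda>s. G a (1 - a - s) * ennreal (s powr (real n / 2 - 1)) * indicator {0<..} s"
      have "(\<integral>\<^sup>+s. ?f s \<partial>lborel) = (\<integral>\<^sup>+b. ?f (1 - a - b) \<partial>lborel)"
        using nn_integral_real_affine[of ?f "-1" "1 - a"] by simp
      also have "\<dots> = (\<integral>\<^sup>+b. ennreal (simplex_weight n \<gamma> \<delta> a b) * h (a, b) \<partial>lborel)"
      proof (rule nn_integral_cong)
        fix b :: real
        have "ennreal (a powr \<alpha> * b powr \<beta> * (1 - a - b) powr (real n / 2 - 1))
          = ennreal (a powr \<alpha> * b powr \<beta>) * ennreal ((1 - a - b) powr (real n / 2 - 1))"
          by (rule ennreal_mult) auto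
        moreover have "simplex_weight n \<gamma> \<delta> a b = (if 0 < a \<and> 0 < b \<and> a + b < 1
          then a powr \<alpha> * b powr \<beta> * (1 - a - b) powr (real n / 2 - 1) else 0)"
          unfolding simplex_weight_def \<alpha>_def \<beta>_def ..
        ultimately show "?f (1 - a - b) = ennreal (simplex_weight n \<gamma> \<delta> a b) * h (a, b)"
          by (auto simp: G_def indicator_def mult_ac)
      qed
      finally show "(\<integral>\<^sup>+y. G a (1 - a - quad_form n A (\<lambda>i. y (i, n))) \<partial>PiM J (\<lambda>_. lborel))
        = ennreal (Determinant.det A powr (- 1 / 2)) * K
          * (\<integral>\<^sup>+b. ennreal (simplex_weight n \<gamma> \<delta> a b) * h (a, b) \<partial>lborel)"
        using K[OF A, of "\<lambda>s. G a (1 - a - s)"] by simp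
    qed
    also have "\<dots> = ennreal (Determinant.det A powr (- 1 / 2)) * K
      * (\<integral>\<^sup>+a. \<integral>\<^sup>+b. ennreal (simplex_weight n \<gamma> \<delta> a b) * h (a, b) \<partial>lborel \<partial>lborel)"
      by (rule nn_integral_cmult) measurable
    also have "ennreal (dV powr \<alpha> * dW powr \<beta>) * (ennreal (Determinant.det A powr (- 1 / 2)) * K
      * (\<integral>\<^sup>+a. \<integral>\<^sup>+b. ennreal (simplex_weight n \<gamma> \<delta> a b) * h (a, b) \<partial>lborel \<partial>lborel))
      = (ennreal (dV powr \<alpha> * dW powr \<beta>) * ennreal (Determinant.det A powr (- 1 / 2)))
      * (K * (\<integral>\<^sup>+a. \<integral>\<^sup>+b. ennreal (simplex_weight n \<gamma> \<delta> a b) * h (a, b) \<partial>lborel \<partial>lborel))"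
      by (simp only: mult.assoc)
    \<comment> \<open>The powers 1/2 coming from det A raise the exponents of size n + 1 to those of
      size n.\<close>
    also have "ennreal (dV powr \<alpha> * dW powr \<beta>) * ennreal (Determinant.det A powr (- 1 / 2))
      = ennreal (beta_weight n \<gamma> \<delta> V)"
    proof -
      have "dV powr \<alpha> * dW powr \<beta> * (dV powr (1 / 2) * dW powr (1 / 2))
        = (dV powr \<alpha> * dV powr (1 / 2)) * (dW powr \<beta> * dW powr (1 / 2))" by (simp only: mult_ac)
      also have "\<dots> = dV powr (\<alpha> + 1 / 2) * dW powr (\<beta> + 1 / 2)" by (simp only: powr_add)
      also have "\<alpha> + 1 / 2 = \<gamma> - (real n + 1) / 2" by (simp add: \<alpha>_def field_simps)
      also have "\<beta> + 1 / 2 = \<delta> - (real n + 1) / 2" by (simp add: \<beta>_def field_simps)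
      finally have "dV powr \<alpha> * dW powr \<beta> * (dV powr (1 / 2) * dW powr (1 / 2)) = beta_weight n \<gamma> \<delta> V"
        using V W by (simp add: beta_weight_symmetric[OF sV] dV_def dW_def)
      moreover have "ennreal (dV powr \<alpha> * dW powr \<beta>) * ennreal (dV powr (1 / 2) * dW powr (1 / 2))
        = ennreal (dV powr \<alpha> * dW powr \<beta> * (dV powr (1 / 2) * dW powr (1 / 2)))"
        by (rule ennreal_mult[symmetric]) auto
      ultimately show ?thesis unfolding det_A by (simp only:)
    qed
    finally show ?thesis .
  qed
  then show ?thesis unfolding J_def by blast
qed

definition schur_ratios :: "nat \<Rightarrow> real mat \<Rightarrow> real \<times> real" where
  "schur_ratios n A = (Determinant.det A / Determinant.det (leading_block n A),
     Determinant.det (1\<^sub>m (Suc n) - A) / Determinant.det (1\<^sub>m n - leading_block n A))"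

lemma measurable_schur_ratios:
  "schur_ratios n \<in> measurable (lebesgue_sym (Suc n)) (borel \<Otimes>\<^sub>M borel)"
proof -
  have [measurable]: "leading_block n \<in> measurable (lebesgue_sym (Suc n)) (lebesgue_sym n)"
    by (rule measurable_leading_block) simp
  note [measurable] =
    measurable_compose[OF measurable_one_minus_lebesgue_sym measurable_det_lebesgue_sym]
    measurable_compose[OF \<open>leading_block n \<in> _\<close> measurable_compose[OF measurable_one_minus_lebesgue_sym
        measurable_det_lebesgue_sym]]
  show ?thesis unfolding schur_ratios_def[abs_def] by measurable
qed

text \<open>Integrating the fibre identity over V. The test function sees V and both ratios
  together, so the right-hand side already exhibits the joint law as a product up to the constant
  \<open>K\<close>.\<close>

lemma nn_integral_beta_weight_Suc:
  fixes \<gamma> \<delta> :: real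
  assumes n: "0 < n"
  shows "\<exists>K. \<forall>h. h \<in> borel_measurable (lebesgue_sym n \<Otimes>\<^sub>M (borel \<Otimes>\<^sub>M borel)) \<longrightarrow>
    (\<integral>\<^sup>+A. ennreal (beta_weight (Suc n) \<gamma> \<delta> A) * h (leading_block n A, schur_ratios n A)
      \<partial>lebesgue_sym (Suc n))
    = K * (\<integral>\<^sup>+V. ennreal (beta_weight n \<gamma> \<delta> V)
        * (\<integral>\<^sup>+a. \<integral>\<^sup>+b. ennreal (simplex_weight n \<gamma> \<delta> a b) * h (V, a, b) \<partial>lborel \<partial>lborel)
      \<partial>lebesgue_sym n)"
proof -
  obtain K where K: "\<And>V h. pos_def n V \<Longrightarrow> pos_def n (1\<^sub>m n - V) \<Longrightarrow> h \<in> borel_measurable (borel \<Otimes>\<^sub>M borel) \<Longrightarrow>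
    (\<integral>\<^sup>+y. \<integral>\<^sup>+w. ennreal (beta_weight (Suc n) \<gamma> \<delta> (bordered_mat n V (\<lambda>i. y (i, n)) w))
        * h (Determinant.det (bordered_mat n V (\<lambda>i. y (i, n)) w) / Determinant.det V,
             Determinant.det (1\<^sub>m (Suc n) - bordered_mat n V (\<lambda>i. y (i, n)) w)
               / Determinant.det (1\<^sub>m n - V)) \<partial>lborel \<partial>PiM ((\<lambda>i. (i, n)) ` {..<n}) (\<lambda>_. lborel))
    = ennreal (beta_weight n \<gamma> \<delta> V)
      * (K * (\<integral>\<^sup>+a. \<integral>\<^sup>+b. ennreal (simplex_weight n \<gamma> \<delta> a b) * h (a, b) \<partial>lborel \<partial>lborel))"
    using nn_integral_bordered_mat[OF n, of \<gamma> \<delta>] by blast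
  have "(\<integral>\<^sup>+A. ennreal (beta_weight (Suc n) \<gamma> \<delta> A) * h (leading_block n A, schur_ratios n A)
      \<partial>lebesgue_sym (Suc n))
    = K * (\<integral>\<^sup>+V. ennreal (beta_weight n \<gamma> \<delta> V)
        * (\<integral>\<^sup>+a. \<integral>\<^sup>+b. ennreal (simplex_weight n \<gamma> \<delta> a b) * h (V, a, b) \<partial>lborel \<partial>lborel)
      \<partial>lebesgue_sym n)" (is "?lhs = _")
    if h [measurable]: "h \<in> borel_measurable (lebesgue_sym n \<Otimes>\<^sub>M (borel \<Otimes>\<^sub>M borel))"
    for h :: "real mat \<times> real \<times> real \<Rightarrow> ennreal"
  proof -
    let ?S = "\<lambda>V. \<integral>\<^sup>+a. \<integral>\<^sup>+b. ennreal (simplex_weight n \<gamma> \<delta> a b) * h (V, a, b) \<partial>lborel \<partial>lborel"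
    note [measurable] = measurable_leading_block[of n "Suc n"] measurable_schur_ratios
    have "?lhs = (\<integral>\<^sup>+x. \<integral>\<^sup>+y. \<integral>\<^sup>+w. ennreal (beta_weight (Suc n) \<gamma> \<delta>
        (bordered_mat n (sym_of_entries n x) (\<lambda>i. y (i, n)) w))
      * h (leading_block n (bordered_mat n (sym_of_entries n x) (\<lambda>i. y (i, n)) w),
           schur_ratios n (bordered_mat n (sym_of_entries n x) (\<lambda>i. y (i, n)) w)) \<partial>lborel
        \<partial>PiM ((\<lambda>i. (i, n)) ` {..<n}) (\<lambda>_. lborel) \<partial>PiM (upper_indices n) (\<lambda>_. lborel))"
      by (rule nn_integral_lebesgue_sym_Suc) measurable
    also have "\<dots> = (\<integral>\<^sup>+x. ennreal (beta_weight n \<gamma> \<delta> (sym_of_entries n x)) * (K * ?S (sym_of_entries n x))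
      \<partial>PiM (upper_indices n) (\<lambda>_. lborel))"
    proof (rule nn_integral_cong)
      fix x :: "nat \<times> nat \<Rightarrow> real"
      define V where "V = sym_of_entries n x"
      have sV: "symmetric_mat n V" and cV: "V \<in> carrier_mat n n"
        unfolding V_def by (simp_all add: symmetric_sym_of_entries)
      have LB: "leading_block n (bordered_mat n V u w) = V" for u w
        by (rule leading_block_bordered_mat[OF cV])
      show "(\<integral>\<^sup>+y. \<integral>\<^sup>+w. ennreal (beta_weight (Suc n) \<gamma> \<delta> (bordered_mat n V (\<lambda>i. y (i, n)) w))
        * h (leading_block n (bordered_mat n V (\<lambda>i. y (i, n)) w),
             schur_ratios n (bordered_mat n V (\<lambda>i. y (i, n)) w)) \<partial>lborel
        \<partial>PiM ((\<lambda>i. (i, n)) ` {..<n}) (\<lambda>_. lborel))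
        = ennreal (beta_weight n \<gamma> \<delta> V) * (K * ?S V)"
      proof (cases "pos_def n V \<and> pos_def n (1\<^sub>m n - V)")
        case True
        have "V \<in> space (lebesgue_sym n)" using sV by (simp add: space_lebesgue_sym)
        then have "(\<lambda>r. h (V, r)) \<in> borel_measurable (borel \<Otimes>\<^sub>M borel)" by measurable
        with K[of V "\<lambda>r. h (V, r)"] True show ?thesis by (simp only: LB schur_ratios_def simp_thms)
      next
        case False
        \<comment> \<open>Leading blocks of positive definite matrices are positive definite, so
          when 0 < V < I fails, U violates the constraint for every border and both sides are
          0.\<close>
        have "beta_weight (Suc n) \<gamma> \<delta> (bordered_mat n V u w) = 0" for u w
        proof -
          let ?U = "bordered_mat n V u w"
          have "\<not> (pos_def (Suc n) ?U \<and> pos_def (Suc n) (1\<^sub>m (Suc n) - ?U))"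
            using pos_def_leading_block[of n ?U] pos_def_leading_block[of n "1\<^sub>m (Suc n) - ?U"] False
              leading_block_one_minus[of ?U "Suc n" n] by (auto simp: LB)
          then show ?thesis
            unfolding beta_weight_symmetric[OF symmetric_bordered_mat[OF sV]] by (rule if_not_P)
        qed
        moreover have "beta_weight n \<gamma> \<delta> V = 0"
          unfolding beta_weight_symmetric[OF sV] using False by (rule if_not_P)
        ultimately show ?thesis by simp
      qed
    qed
    also have "\<dots> = (\<integral>\<^sup>+V. ennreal (beta_weight n \<gamma> \<delta> V) * (K * ?S V) \<partial>lebesgue_sym n)"
      by (rule nn_integral_lebesgue_sym[symmetric]) measurable
    also have "\<dots> = (\<integral>\<^sup>+V. K * (ennreal (beta_weight n \<gamma> \<delta> V) * ?S V) \<partial>lebesgue_sym n)"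
      by (intro nn_integral_cong) (simp only: mult_ac)
    also have "\<dots> = K * (\<integral>\<^sup>+V. ennreal (beta_weight n \<gamma> \<delta> V) * ?S V \<partial>lebesgue_sym n)"
      by (rule nn_integral_cmult) measurable
    finally show ?thesis .
  qed
  then show ?thesis by blast
qed

section \<open>Laws and proportionality\<close>

lemma sets_density_prop [simp]: "sets (density_prop L f) = sets L"
  by (simp add: density_prop_def)

lemma nn_integral_density_prop:
  assumes [measurable]: "f \<in> borel_measurable L" "g \<in> borel_measurable L"
  shows "(\<integral>\<^sup>+x. g x \<partial>density_prop L f)
    = inverse (\<integral>\<^sup>+x. ennreal (f x) \<partial>L) * (\<integral>\<^sup>+x. ennreal (f x) * g x \<partial>L)"
proof -
  have "(\<integral>\<^sup>+x. g x \<partial>density_prop L f)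
    = (\<integral>\<^sup>+x. inverse (\<integral>\<^sup>+x. ennreal (f x) \<partial>L) * (ennreal (f x) * g x) \<partial>L)"
    unfolding density_prop_def
    by (subst nn_integral_density) (auto simp: divide_ennreal_def mult_ac)
  then show ?thesis by (simp add: nn_integral_cmult)
qed

text \<open>The values 0 and infinity are exactly those at which a number times its inverse is not 1
  in the extended nonnegative reals.\<close>

lemma prob_space_density_prop:
  assumes f [measurable]: "f \<in> borel_measurable L"
    and "(\<integral>\<^sup>+x. ennreal (f x) \<partial>L) \<noteq> 0" "(\<integral>\<^sup>+x. ennreal (f x) \<partial>L) \<noteq> \<infinity>"
  shows "prob_space (density_prop L f)"
proof (rule prob_spaceI)
  have "emeasure (density_prop L f) (space (density_prop L f)) = (\<integral>\<^sup>+x. 1 \<partial>density_prop L f)"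
    by simp
  also have "\<dots> = inverse (\<integral>\<^sup>+x. ennreal (f x) \<partial>L) * (\<integral>\<^sup>+x. ennreal (f x) \<partial>L)"
    by (subst nn_integral_density_prop) auto
  also have "\<dots> = 1"
    using assms by (simp add: ennreal_inverse_mult top.not_eq_extremum mult.commute divide_ennreal_def[symmetric])
  finally show "emeasure (density_prop L f) (space (density_prop L f)) = 1" .
qed

lemma matrix_beta_eq: "matrix_beta p \<gamma> \<delta> = density_prop (lebesgue_sym p) (beta_weight p \<gamma> \<delta>)"
  unfolding matrix_beta_def beta_weight_def[abs_def] ..

text \<open>On rectangles the product law factorises. Taking the whole space as one side gives the
  two marginals, and substituting these back gives independence.\<close>

lemma has_law_pairD:
  assumes M: "prob_space M" and S: "prob_space S" and T: "prob_space T"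
    and law: "has_law M (\<lambda>\<omega>. (X \<omega>, Y \<omega>)) (S \<Otimes>\<^sub>M T)"
  shows "has_law M X S" "has_law M Y T" "indep_rv M S X T Y"
proof -
  interpret M: prob_space M by fact
  interpret S: prob_space S by fact
  interpret T: prob_space T by fact
  interpret ST: pair_prob_space S T ..
  have XY: "(\<lambda>\<omega>. (X \<omega>, Y \<omega>)) \<in> measurable M (S \<Otimes>\<^sub>M T)"
    and D: "distr M (S \<Otimes>\<^sub>M T) (\<lambda>\<omega>. (X \<omega>, Y \<omega>)) = S \<Otimes>\<^sub>M T"
    using law by (auto simp: has_law_def)
  have X [measurable]: "X \<in> measurable M S" using measurable_compose[OF XY measurable_fst] by simp
  have Y [measurable]: "Y \<in> measurable M T" using measurable_compose[OF XY measurable_snd] by simp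
  have box: "emeasure M ((X -` A \<inter> space M) \<inter> (Y -` B \<inter> space M)) = emeasure S A * emeasure T B"
    if [measurable]: "A \<in> sets S" "B \<in> sets T" for A B
  proof -
    have "emeasure S A * emeasure T B = emeasure (distr M (S \<Otimes>\<^sub>M T) (\<lambda>\<omega>. (X \<omega>, Y \<omega>))) (A \<times> B)"
      unfolding D by (rule T.emeasure_pair_measure_Times[symmetric]) fact+
    also have "\<dots> = emeasure M ((\<lambda>\<omega>. (X \<omega>, Y \<omega>)) -` (A \<times> B) \<inter> space M)"
      by (rule emeasure_distr[OF XY]) measurable
    also have "(\<lambda>\<omega>. (X \<omega>, Y \<omega>)) -` (A \<times> B) \<inter> space M = (X -` A \<inter> space M) \<inter> (Y -` B \<inter> space M)"
      by auto
    finally show ?thesis ..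
  qed
  have eX: "emeasure M (X -` A \<inter> space M) = emeasure S A" if "A \<in> sets S" for A
  proof -
    have "Y -` space T \<inter> space M = space M" using measurable_space[OF Y] by auto
    then show ?thesis using box[OF that sets.top] by (simp add: T.emeasure_space_1 Int_absorb2 Int_assoc)
  qed
  have eY: "emeasure M (Y -` B \<inter> space M) = emeasure T B" if "B \<in> sets T" for B
  proof -
    have "X -` space S \<inter> space M = space M" using measurable_space[OF X] by auto
    then show ?thesis using box[OF sets.top that] by (simp add: S.emeasure_space_1 Int_absorb1)
  qed
  show "has_law M X S"
    unfolding has_law_def using eX by (auto intro!: measure_eqI X simp: emeasure_distr)
  show "has_law M Y T"
    unfolding has_law_def using eY by (auto intro!: measure_eqI Y simp: emeasure_distr)
  show "indep_rv M S X T Y"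
    unfolding indep_rv_def
  proof (intro conjI X Y M.indep_setI)
    fix a b assume "a \<in> {X -` A \<inter> space M |A. A \<in> sets S}" "b \<in> {Y -` B \<inter> space M |B. B \<in> sets T}"
    then obtain A B where AB: "A \<in> sets S" "B \<in> sets T" "a = X -` A \<inter> space M" "b = Y -` B \<inter> space M"
      by blast
    then have "emeasure M (a \<inter> b) = emeasure M a * emeasure M b"
      using box[of A B] eX[of A] eY[of B] by simp
    then show "M.prob (a \<inter> b) = M.prob a * M.prob b"
      by (simp add: measure_def enn2real_mult)
  qed (auto intro: measurable_sets)
qed

text \<open>This is how the evaluation of constants is avoided. Both factors are inverse to the same
  number, the value of \<Phi> on the whole space; c = c (d F) = d (c F) = d uses no division, so it
  is sound for extended reals.\<close>

lemma proportional_prob_spaces_eq: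
  assumes "prob_space M" "prob_space N" and sets: "sets M = sets N"
    and M: "\<And>A. A \<in> sets M \<Longrightarrow> emeasure M A = c * \<Phi> A"
    and N: "\<And>A. A \<in> sets M \<Longrightarrow> emeasure N A = d * \<Phi> A"
  shows "M = N"
proof (rule measure_eqI[OF sets])
  interpret M: prob_space M by fact
  interpret N: prob_space N by fact
  let ?F = "\<Phi> (space M)"
  have "c * ?F = 1" using M[OF sets.top] by (simp add: M.emeasure_space_1)
  moreover have "d * ?F = 1"
    using N[OF sets.top] sets_eq_imp_space_eq[OF sets] by (simp add: N.emeasure_space_1)
  ultimately have "c = d" by (metis mult.assoc mult.commute mult.right_neutral)
  then show "emeasure M A = emeasure N A" if "A \<in> sets M" for A using M[OF that] N[OF that] by simp
qed

section \<open>Beta laws, the Dirichlet weight and the joint law\<close>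

definition beta_density :: "real \<Rightarrow> real \<Rightarrow> real \<Rightarrow> real" where
  "beta_density a b x = (if 0 < x \<and> x < 1 then x powr (a - 1) * (1 - x) powr (b - 1) else 0)"

lemma measurable_beta_density [measurable]: "beta_density a b \<in> borel_measurable borel"
  unfolding beta_density_def[abs_def] by measurable

lemma beta_distribution_eq: "beta_distribution a b = density_prop lborel (beta_density a b)"
  unfolding beta_distribution_def beta_density_def[abs_def] ..

text \<open>The substitution \<open>b = (1 - x) y\<close> turns the product of the two beta densities into the
  Dirichlet density of \<open>(x, b)\<close>.\<close>

lemma nn_integral_simplex_weight:
  fixes h :: "real \<Rightarrow> ennreal"
  assumes [measurable]: "h \<in> borel_measurable borel"
  shows "(\<integral>\<^sup>+b. ennreal (simplex_weight n \<gamma> \<delta> x b) * h b \<partial>lborel)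
    = ennreal (beta_density (\<gamma> - real n / 2) \<delta> x)
      * (\<integral>\<^sup>+y. ennreal (beta_density (\<delta> - real n / 2) (real n / 2) y) * h ((1 - x) * y) \<partial>lborel)"
proof (cases "0 < x \<and> x < 1")
  case x: True
  \<comment> \<open>The leading factor 1 - x is the derivative of b = (1 - x) y with respect to
    y.\<close>
  have pt: "(1 - x) * simplex_weight n \<gamma> \<delta> x ((1 - x) * y)
    = beta_density (\<gamma> - real n / 2) \<delta> x * beta_density (\<delta> - real n / 2) (real n / 2) y" for y
  proof (cases "0 < y \<and> y < 1")
    case y: True
    have "x + (1 - x) * y < x + (1 - x) * 1" using x y by (intro add_strict_left_mono mult_strict_left_mono) auto
    then have supp: "0 < x \<and> 0 < (1 - x) * y \<and> x + (1 - x) * y < 1" using x y by simp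
    have e1: "\<gamma> - (real (Suc n) + 1) / 2 = \<gamma> - real n / 2 - 1" by (simp add: field_simps)
    have e2: "\<delta> - (real (Suc n) + 1) / 2 = \<delta> - real n / 2 - 1" by (simp add: field_simps)
    have e3: "1 - x - (1 - x) * y = (1 - x) * (1 - y)" by (simp add: algebra_simps)
    \<comment> \<open>Three powers of 1 - x meet: one from the derivative, one from b = (1 - x) y,
      one from 1 - x - b = (1 - x) (1 - y). Their exponents 1, \<delta> - n/2 - 1 and n/2 - 1 sum to
      \<delta> - 1, which is why the first beta law has second parameter \<delta>.\<close>
    have "(1 - x) * ((1 - x) powr (\<delta> - real n / 2 - 1) * (1 - x) powr (real n / 2 - 1))
      = (1 - x) powr 1 * ((1 - x) powr (\<delta> - real n / 2 - 1) * (1 - x) powr (real n / 2 - 1))"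
      using x by simp
    also have "\<dots> = (1 - x) powr (\<delta> - 1)" unfolding powr_add[symmetric] by simp
    finally have p: "(1 - x) * ((1 - x) powr (\<delta> - real n / 2 - 1) * (1 - x) powr (real n / 2 - 1))
      = (1 - x) powr (\<delta> - 1)" .
    have "(1 - x) * simplex_weight n \<gamma> \<delta> x ((1 - x) * y)
      = (1 - x) * (x powr (\<gamma> - real n / 2 - 1) * ((1 - x) powr (\<delta> - real n / 2 - 1) * y powr (\<delta> - real n / 2 - 1))
        * ((1 - x) powr (real n / 2 - 1) * (1 - y) powr (real n / 2 - 1)))"
      unfolding simplex_weight_def if_P[OF supp] e1 e2 e3 using x y by (simp only: powr_mult)
    also have "\<dots> = x powr (\<gamma> - real n / 2 - 1)
      * ((1 - x) * ((1 - x) powr (\<delta> - real n / 2 - 1) * (1 - x) powr (real n / 2 - 1)))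
      * (y powr (\<delta> - real n / 2 - 1) * (1 - y) powr (real n / 2 - 1))"
      by (simp only: mult_ac)
    finally show ?thesis unfolding p beta_density_def if_P[OF x] if_P[OF y] .
  next
    case False
    have "\<not> (0 < (1 - x) * y \<and> x + (1 - x) * y < 1)"
    proof
      assume *: "0 < (1 - x) * y \<and> x + (1 - x) * y < 1"
      then have "0 < y" using x by (simp add: zero_less_mult_iff)
      moreover have "0 < (1 - x) * (1 - y)" using * by (simp add: algebra_simps)
      then have "y < 1" using x by (simp add: zero_less_mult_iff)
      ultimately show False using False by simp
    qed
    then show ?thesis using False by (auto simp: simplex_weight_def beta_density_def)
  qed
  have "(\<integral>\<^sup>+b. ennreal (simplex_weight n \<gamma> \<delta> x b) * h b \<partial>lborel)
    = ennreal (1 - x) * (\<integral>\<^sup>+y. ennreal (simplex_weight n \<gamma> \<delta> x ((1 - x) * y)) * h ((1 - x) * y) \<partial>lborel)"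
    using nn_integral_real_affine[of "\<lambda>b. ennreal (simplex_weight n \<gamma> \<delta> x b) * h b" "1 - x" 0] x by simp
  also have "\<dots> = (\<integral>\<^sup>+y. ennreal (1 - x) * (ennreal (simplex_weight n \<gamma> \<delta> x ((1 - x) * y)) * h ((1 - x) * y)) \<partial>lborel)"
    by (rule nn_integral_cmult[symmetric]) measurable
  also have "\<dots> = (\<integral>\<^sup>+y. ennreal (beta_density (\<gamma> - real n / 2) \<delta> x)
      * (ennreal (beta_density (\<delta> - real n / 2) (real n / 2) y) * h ((1 - x) * y)) \<partial>lborel)"
  proof (rule nn_integral_cong)
    fix y
    have "ennreal (1 - x) * ennreal (simplex_weight n \<gamma> \<delta> x ((1 - x) * y))
      = ennreal ((1 - x) * simplex_weight n \<gamma> \<delta> x ((1 - x) * y))"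
      using x by (intro ennreal_mult[symmetric]) (auto simp: simplex_weight_def)
    also have "\<dots> = ennreal (beta_density (\<gamma> - real n / 2) \<delta> x)
      * ennreal (beta_density (\<delta> - real n / 2) (real n / 2) y)"
      unfolding pt by (intro ennreal_mult) (auto simp: beta_density_def)
    finally show "ennreal (1 - x) * (ennreal (simplex_weight n \<gamma> \<delta> x ((1 - x) * y)) * h ((1 - x) * y))
      = ennreal (beta_density (\<gamma> - real n / 2) \<delta> x)
      * (ennreal (beta_density (\<delta> - real n / 2) (real n / 2) y) * h ((1 - x) * y))"
      by (simp only: mult.assoc[symmetric])
  qed
  also have "\<dots> = ennreal (beta_density (\<gamma> - real n / 2) \<delta> x)
      * (\<integral>\<^sup>+y. ennreal (beta_density (\<delta> - real n / 2) (real n / 2) y) * h ((1 - x) * y) \<partial>lborel)"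
    by (rule nn_integral_cmult) measurable
  finally show ?thesis .
next
  case False
  then have "simplex_weight n \<gamma> \<delta> x b = 0" for b by (auto simp: simplex_weight_def)
  moreover have "beta_density (\<gamma> - real n / 2) \<delta> x = 0" using False by (auto simp: beta_density_def)
  ultimately show ?thesis by simp
qed

text \<open>By independence the pair has the product of the two beta laws, and
  \<open>nn_integral_simplex_weight\<close> rewrites its density as the Dirichlet weight. The
  constant is the product of the two inverse normalisers.\<close>

lemma nn_integral_beta_pair:
  fixes N :: "'b measure"
  assumes N: "prob_space N"
    and P1: "has_law N P1 (beta_distribution (\<gamma> - real n / 2) \<delta>)"
    and P2: "has_law N P2 (beta_distribution (\<delta> - real n / 2) (real n / 2))"
    and indep: "prob_space.indep_var N borel P1 borel P2"
  shows "\<exists>c. \<forall>h. h \<in> borel_measurable (borel \<Otimes>\<^sub>M borel) \<longrightarrow>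
    (\<integral>\<^sup>+\<omega>. h (P1 \<omega>, (1 - P1 \<omega>) * P2 \<omega>) \<partial>N)
    = c * (\<integral>\<^sup>+a. \<integral>\<^sup>+b. ennreal (simplex_weight n \<gamma> \<delta> a b) * h (a, b) \<partial>lborel \<partial>lborel)"
proof -
  interpret N: prob_space N by fact
  let ?f1 = "beta_density (\<gamma> - real n / 2) \<delta>" and ?f2 = "beta_density (\<delta> - real n / 2) (real n / 2)"
  let ?B1 = "beta_distribution (\<gamma> - real n / 2) \<delta>" and ?B2 = "beta_distribution (\<delta> - real n / 2) (real n / 2)"
  define z1 z2 where "z1 = inverse (\<integral>\<^sup>+x. ennreal (?f1 x) \<partial>lborel)" and "z2 = inverse (\<integral>\<^sup>+x. ennreal (?f2 x) \<partial>lborel)"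
  have sets_B [measurable_cong]: "sets (beta_distribution a b) = sets borel" for a b
    by (simp add: beta_distribution_eq)
  \<comment> \<open>\<open>has_law\<close> takes its target sigma-algebra from the law while
    \<open>indep_var\<close> uses \<open>borel\<close>; the two coincide.\<close>
  have "distr N borel P1 = distr N ?B1 P1" "distr N borel P2 = distr N ?B2 P2"
    by (rule distr_cong; simp add: sets_B)+
  then have D1: "distr N borel P1 = ?B1" and D2: "distr N borel P2 = ?B2"
    using P1 P2 by (simp_all add: has_law_def)
  have [measurable]: "P1 \<in> borel_measurable N" "P2 \<in> borel_measurable N"
    and prod: "?B1 \<Otimes>\<^sub>M ?B2 = distr N (borel \<Otimes>\<^sub>M borel) (\<lambda>\<omega>. (P1 \<omega>, P2 \<omega>))"
    using indep unfolding N.indep_var_distribution_eq D1 D2 by auto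
  have "prob_space ?B2" unfolding D2[symmetric] by (rule N.prob_space_distr) measurable
  then interpret B2: prob_space ?B2 .
  have "(\<integral>\<^sup>+\<omega>. h (P1 \<omega>, (1 - P1 \<omega>) * P2 \<omega>) \<partial>N)
    = (z1 * z2) * (\<integral>\<^sup>+a. \<integral>\<^sup>+b. ennreal (simplex_weight n \<gamma> \<delta> a b) * h (a, b) \<partial>lborel \<partial>lborel)"
    if h [measurable]: "h \<in> borel_measurable (borel \<Otimes>\<^sub>M borel)" for h :: "real \<times> real \<Rightarrow> ennreal"
  proof -
    have "(\<integral>\<^sup>+\<omega>. h (P1 \<omega>, (1 - P1 \<omega>) * P2 \<omega>) \<partial>N)
      = (\<integral>\<^sup>+z. h (fst z, (1 - fst z) * snd z) \<partial>(?B1 \<Otimes>\<^sub>M ?B2))"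
      unfolding prod by (subst nn_integral_distr) auto
    also have "\<dots> = (\<integral>\<^sup>+x. \<integral>\<^sup>+y. h (x, (1 - x) * y) \<partial>?B2 \<partial>?B1)"
      by (subst B2.nn_integral_fst[symmetric]) auto
    also have "\<dots> = (\<integral>\<^sup>+x. z2 * (\<integral>\<^sup>+y. ennreal (?f2 y) * h (x, (1 - x) * y) \<partial>lborel) \<partial>?B1)"
      unfolding z2_def by (intro nn_integral_cong)
        (simp add: beta_distribution_eq nn_integral_density_prop)
    also have "\<dots> = z1 * (\<integral>\<^sup>+x. ennreal (?f1 x)
        * (z2 * (\<integral>\<^sup>+y. ennreal (?f2 y) * h (x, (1 - x) * y) \<partial>lborel)) \<partial>lborel)"
      unfolding z1_def beta_distribution_eq by (rule nn_integral_density_prop) measurable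
    also have "(\<integral>\<^sup>+x. ennreal (?f1 x)
        * (z2 * (\<integral>\<^sup>+y. ennreal (?f2 y) * h (x, (1 - x) * y) \<partial>lborel)) \<partial>lborel)
      = (\<integral>\<^sup>+x. z2 * (\<integral>\<^sup>+b. ennreal (simplex_weight n \<gamma> \<delta> x b) * h (x, b) \<partial>lborel) \<partial>lborel)"
      by (intro nn_integral_cong) (simp add: nn_integral_simplex_weight mult.left_commute)
    also have "\<dots> = z2 * (\<integral>\<^sup>+x. \<integral>\<^sup>+b. ennreal (simplex_weight n \<gamma> \<delta> x b) * h (x, b) \<partial>lborel \<partial>lborel)"
      by (rule nn_integral_cmult) measurable
    finally show ?thesis by (simp only: mult.assoc)
  qed
  then show ?thesis by blast
qed

text \<open>The image law and the claimed product are both multiples of one set function and both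
  have mass one, hence are equal. That the law of size n is a probability measure is part of the
  conclusion.\<close>

lemma matrix_beta_Suc_has_law:
  fixes M :: "'a measure" and N :: "'b measure"
  assumes n: "0 < n" and M: "prob_space M" and U: "has_law M U (matrix_beta (Suc n) \<gamma> \<delta>)"
    and N: "prob_space N"
    and P1: "has_law N P1 (beta_distribution (\<gamma> - real n / 2) \<delta>)"
    and P2: "has_law N P2 (beta_distribution (\<delta> - real n / 2) (real n / 2))"
    and indep: "prob_space.indep_var N borel P1 borel P2"
  defines "Q \<equiv> distr N (borel \<Otimes>\<^sub>M borel) (\<lambda>\<omega>. (P1 \<omega>, (1 - P1 \<omega>) * P2 \<omega>))"
  shows "prob_space (matrix_beta n \<gamma> \<delta>)" "prob_space Q"
    "has_law M (\<lambda>\<omega>. (leading_block n (U \<omega>), schur_ratios n (U \<omega>))) (matrix_beta n \<gamma> \<delta> \<Otimes>\<^sub>M Q)"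
proof -
  interpret M: prob_space M by fact
  interpret N: prob_space N by fact
  let ?L = "lebesgue_sym n" and ?L' = "lebesgue_sym (Suc n)" and ?R = "borel \<Otimes>\<^sub>M borel :: (real \<times> real) measure"
  let ?X = "\<lambda>A. (leading_block n A, schur_ratios n A)"
  have sets_mb [measurable_cong]: "sets (matrix_beta p \<gamma> \<delta>) = sets (lebesgue_sym p)" for p
    by (simp add: matrix_beta_eq)
  have sets_Q [measurable_cong]: "sets Q = sets ?R" by (simp add: Q_def)
  have P [measurable]: "P1 \<in> borel_measurable N" "P2 \<in> borel_measurable N"
    using indep unfolding N.indep_var_distribution_eq by auto
  have U_meas [measurable]: "U \<in> measurable M ?L'" and U_distr: "distr M (matrix_beta (Suc n) \<gamma> \<delta>) U = matrix_beta (Suc n) \<gamma> \<delta>"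
    using U measurable_cong_sets[OF refl sets_mb, of M "Suc n"] by (auto simp: has_law_def)
  have X [measurable]: "?X \<in> measurable ?L' (?L \<Otimes>\<^sub>M ?R)"
    by (intro measurable_Pair measurable_schur_ratios measurable_leading_block) simp
  show Q: "prob_space Q" unfolding Q_def by (rule N.prob_space_distr) measurable
  then interpret Q: prob_space Q .
  obtain K where K: "\<And>h. h \<in> borel_measurable (?L \<Otimes>\<^sub>M ?R) \<Longrightarrow>
    (\<integral>\<^sup>+A. ennreal (beta_weight (Suc n) \<gamma> \<delta> A) * h (?X A) \<partial>?L')
    = K * (\<integral>\<^sup>+V. ennreal (beta_weight n \<gamma> \<delta> V)
        * (\<integral>\<^sup>+a. \<integral>\<^sup>+b. ennreal (simplex_weight n \<gamma> \<delta> a b) * h (V, a, b) \<partial>lborel \<partial>lborel) \<partial>?L)"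
    using nn_integral_beta_weight_Suc[OF n, of \<gamma> \<delta>] by blast
  obtain c where c: "\<And>h. h \<in> borel_measurable ?R \<Longrightarrow>
    (\<integral>\<^sup>+\<omega>. h (P1 \<omega>, (1 - P1 \<omega>) * P2 \<omega>) \<partial>N)
    = c * (\<integral>\<^sup>+a. \<integral>\<^sup>+b. ennreal (simplex_weight n \<gamma> \<delta> a b) * h (a, b) \<partial>lborel \<partial>lborel)"
    using nn_integral_beta_pair[OF N P1 P2 indep] by blast
  \<comment> \<open>The common unnormalised set function: matrix weight in V times Dirichlet weight
    in (a, b).\<close>
  define \<Phi> where "\<Phi> E = (\<integral>\<^sup>+V. ennreal (beta_weight n \<gamma> \<delta> V)
    * (\<integral>\<^sup>+a. \<integral>\<^sup>+b. ennreal (simplex_weight n \<gamma> \<delta> a b) * indicator E (V, a, b) \<partial>lborel \<partial>lborel) \<partial>?L)"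
    for E :: "(real mat \<times> real \<times> real) set"
  define z where "z p = inverse (\<integral>\<^sup>+A. ennreal (beta_weight p \<gamma> \<delta> A) \<partial>lebesgue_sym p)" for p
  let ?\<mu> = "distr M (matrix_beta n \<gamma> \<delta> \<Otimes>\<^sub>M Q) (\<lambda>\<omega>. ?X (U \<omega>))"
  have XU [measurable]: "(\<lambda>\<omega>. ?X (U \<omega>)) \<in> measurable M (matrix_beta n \<gamma> \<delta> \<Otimes>\<^sub>M Q)"
    using measurable_compose[OF U_meas X]
    by (simp cong: measurable_cong_sets add: measurable_cong_sets[OF refl sets_pair_measure_cong[OF sets_mb sets_Q]])
  have \<mu>: "emeasure ?\<mu> E = (z (Suc n) * K) * \<Phi> E" if "E \<in> sets (?L \<Otimes>\<^sub>M ?R)" for E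
  proof -
    have [measurable]: "E \<in> sets (?L \<Otimes>\<^sub>M ?R)" by fact
    have "emeasure ?\<mu> E = (\<integral>\<^sup>+x. indicator E x \<partial>?\<mu>)"
      using that by (simp add: sets_pair_measure_cong[OF sets_mb sets_Q])
    also have "\<dots> = (\<integral>\<^sup>+\<omega>. indicator E (?X (U \<omega>)) \<partial>M)"
      by (rule nn_integral_distr[OF XU]) measurable
    also have "\<dots> = (\<integral>\<^sup>+A. indicator E (?X A) \<partial>distr M (matrix_beta (Suc n) \<gamma> \<delta>) U)"
      by (rule nn_integral_distr[symmetric]) measurable
    also have "\<dots> = z (Suc n) * (\<integral>\<^sup>+A. ennreal (beta_weight (Suc n) \<gamma> \<delta> A) * indicator E (?X A) \<partial>?L')"
      unfolding U_distr unfolding matrix_beta_eq z_def by (rule nn_integral_density_prop) measurable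
    also have "(\<integral>\<^sup>+A. ennreal (beta_weight (Suc n) \<gamma> \<delta> A) * indicator E (?X A) \<partial>?L') = K * \<Phi> E"
      unfolding \<Phi>_def by (rule K) measurable
    finally show ?thesis by (simp only: mult.assoc)
  qed
  have "prob_space ?\<mu>" by (rule M.prob_space_distr[OF XU])
  then interpret \<mu>: prob_space ?\<mu> .
  define S where "S = (\<integral>\<^sup>+a. \<integral>\<^sup>+b. ennreal (simplex_weight n \<gamma> \<delta> a b) * 1 \<partial>lborel \<partial>lborel)"
  have cS: "c * S = 1" using c[of "\<lambda>_. 1"] by (simp add: S_def N.emeasure_space_1)
  let ?Z = "\<integral>\<^sup>+V. ennreal (beta_weight n \<gamma> \<delta> V) \<partial>?L"
  have "\<Phi> (space (?L \<Otimes>\<^sub>M ?R)) = (\<integral>\<^sup>+V. ennreal (beta_weight n \<gamma> \<delta> V) * S \<partial>?L)"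
    unfolding \<Phi>_def S_def
    by (intro nn_integral_cong) (simp add: space_pair_measure)
  also have "\<dots> = ?Z * S" by (rule nn_integral_multc) measurable
  \<comment> \<open>Total mass of the image law. In the extended nonnegative reals a product equal
    to 1 has no factor 0 or infinity, so the normaliser of size n is positive and finite.\<close>
  finally have "(z (Suc n) * K) * (?Z * S) = 1"
    using \<mu>[OF sets.top] \<mu>.emeasure_space_1
    by (simp add: space_pair_measure sets_eq_imp_space_eq[OF sets_mb] sets_eq_imp_space_eq[OF sets_Q])
  then have "?Z \<noteq> 0" "?Z \<noteq> \<infinity>"
    by (auto simp: ennreal_mult_top ennreal_top_mult split: if_splits)
  then show mb: "prob_space (matrix_beta n \<gamma> \<delta>)"
    unfolding matrix_beta_eq by (intro prob_space_density_prop) auto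
  then interpret mb: prob_space "matrix_beta n \<gamma> \<delta>" .
  interpret pair_prob_space "matrix_beta n \<gamma> \<delta>" Q ..
  have \<nu>: "emeasure (matrix_beta n \<gamma> \<delta> \<Otimes>\<^sub>M Q) E = (z n * c) * \<Phi> E" if "E \<in> sets (?L \<Otimes>\<^sub>M ?R)" for E
  proof -
    have E [measurable]: "E \<in> sets (?L \<Otimes>\<^sub>M ?R)" by fact
    then have "E \<in> sets (matrix_beta n \<gamma> \<delta> \<Otimes>\<^sub>M Q)"
      by (simp add: sets_pair_measure_cong[OF sets_mb sets_Q])
    then have "emeasure (matrix_beta n \<gamma> \<delta> \<Otimes>\<^sub>M Q) E
      = (\<integral>\<^sup>+V. \<integral>\<^sup>+r. indicator E (V, r) \<partial>Q \<partial>matrix_beta n \<gamma> \<delta>)"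
      by (rule Q.emeasure_pair_measure)
    also have "\<dots> = (\<integral>\<^sup>+V. c * (\<integral>\<^sup>+a. \<integral>\<^sup>+b. ennreal (simplex_weight n \<gamma> \<delta> a b)
      * indicator E (V, a, b) \<partial>lborel \<partial>lborel) \<partial>matrix_beta n \<gamma> \<delta>)"
    proof (rule nn_integral_cong)
      fix V assume "V \<in> space (matrix_beta n \<gamma> \<delta>)"
      then have "V \<in> space ?L" by (simp add: sets_eq_imp_space_eq[OF sets_mb])
      then have [measurable]: "(\<lambda>r. indicator E (V, r) :: ennreal) \<in> borel_measurable ?R" by measurable
      have "(\<integral>\<^sup>+r. indicator E (V, r) \<partial>Q) = (\<integral>\<^sup>+\<omega>. indicator E (V, P1 \<omega>, (1 - P1 \<omega>) * P2 \<omega>) \<partial>N)"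
        unfolding Q_def by (rule nn_integral_distr) measurable
      then show "(\<integral>\<^sup>+r. indicator E (V, r) \<partial>Q) = c * (\<integral>\<^sup>+a. \<integral>\<^sup>+b. ennreal (simplex_weight n \<gamma> \<delta> a b)
        * indicator E (V, a, b) \<partial>lborel \<partial>lborel)"
        using c[of "\<lambda>r. indicator E (V, r)"] by simp
    qed
    also have "\<dots> = z n * (\<integral>\<^sup>+V. ennreal (beta_weight n \<gamma> \<delta> V) * (c * (\<integral>\<^sup>+a. \<integral>\<^sup>+b.
      ennreal (simplex_weight n \<gamma> \<delta> a b) * indicator E (V, a, b) \<partial>lborel \<partial>lborel)) \<partial>?L)"
      unfolding matrix_beta_eq z_def by (rule nn_integral_density_prop) measurable
    also have "(\<integral>\<^sup>+V. ennreal (beta_weight n \<gamma> \<delta> V) * (c * (\<integral>\<^sup>+a. \<integral>\<^sup>+b.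
      ennreal (simplex_weight n \<gamma> \<delta> a b) * indicator E (V, a, b) \<partial>lborel \<partial>lborel)) \<partial>?L) = c * \<Phi> E"
      unfolding \<Phi>_def by (subst nn_integral_cmult[symmetric]) (auto simp: mult_ac)
    finally show ?thesis by (simp only: mult.assoc)
  qed
  have "?\<mu> = matrix_beta n \<gamma> \<delta> \<Otimes>\<^sub>M Q"
  proof (rule proportional_prob_spaces_eq[where \<Phi> = \<Phi>])
    show "prob_space ?\<mu>" "prob_space (matrix_beta n \<gamma> \<delta> \<Otimes>\<^sub>M Q)" by unfold_locales
  qed (use \<mu> \<nu> in \<open>simp_all add: sets_pair_measure_cong[OF sets_mb sets_Q]\<close>)
  with XU show "has_law M (\<lambda>\<omega>. ?X (U \<omega>)) (matrix_beta n \<gamma> \<delta> \<Otimes>\<^sub>M Q)"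
    by (simp add: has_law_def)
qed

theorem theorem3p1:
  fixes M :: "'a measure" and N :: "'b measure"
    and U :: "'a \<Rightarrow> real mat" and P1 P2 :: "'b \<Rightarrow> real"
    and p :: nat and \<gamma> \<delta> :: real
  defines "V \<equiv> \<lambda>\<omega>. leading_block (p - 1) (U \<omega>)"
    and "R \<equiv> \<lambda>\<omega>. (Determinant.det (U \<omega>) / Determinant.det (leading_block (p - 1) (U \<omega>)),
                   Determinant.det (1\<^sub>m p - U \<omega>) /
                     Determinant.det (1\<^sub>m (p - 1) - leading_block (p - 1) (U \<omega>)))"
    and "Q \<equiv> distr N (borel \<Otimes>\<^sub>M borel) (\<lambda>\<omega>. (P1 \<omega>, (1 - P1 \<omega>) * P2 \<omega>))"
  assumes "p > 1"
    and "\<gamma> > (real p - 1) / 2" and "\<delta> > (real p - 1) / 2"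
    and "prob_space M" and "has_law M U (matrix_beta p \<gamma> \<delta>)"
    and "prob_space N"
    and "has_law N P1 (beta_distribution (\<gamma> - (real p - 1) / 2) \<delta>)"
    and "has_law N P2 (beta_distribution (\<delta> - (real p - 1) / 2) ((real p - 1) / 2))"
    and "prob_space.indep_var N borel P1 borel P2"
  shows "has_law M (\<lambda>\<omega>. (V \<omega>, R \<omega>)) (matrix_beta (p - 1) \<gamma> \<delta> \<Otimes>\<^sub>M Q)
    \<and> indep_rv M (matrix_beta (p - 1) \<gamma> \<delta>) V (borel \<Otimes>\<^sub>M borel) R
    \<and> has_law M V (matrix_beta (p - 1) \<gamma> \<delta>)
    \<and> has_law M R Q"
proof -
  obtain n where p: "p = Suc n" and n: "0 < n" using \<open>p > 1\<close> by (cases p) auto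
  have VR: "V = (\<lambda>\<omega>. leading_block n (U \<omega>))" "R = (\<lambda>\<omega>. schur_ratios n (U \<omega>))"
    by (simp_all add: V_def R_def schur_ratios_def p)
  have half: "(real p - 1) / 2 = real n / 2" by (simp add: p)
  note law = matrix_beta_Suc_has_law[OF n \<open>prob_space M\<close> _ \<open>prob_space N\<close>,
      OF assms(8)[unfolded p] assms(10,11)[unfolded half] assms(12), folded Q_def]
  have joint: "has_law M (\<lambda>\<omega>. (V \<omega>, R \<omega>)) (matrix_beta n \<gamma> \<delta> \<Otimes>\<^sub>M Q)"
    unfolding VR by (rule law(3))
  have sets_Q: "sets Q = sets (borel \<Otimes>\<^sub>M borel)" by (simp add: Q_def)
  \<comment> \<open>\<open>indep_rv\<close> depends on the target \<open>Q\<close> only through its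
    sigma-algebra, which is the Borel one.\<close>
  have "indep_rv M (matrix_beta n \<gamma> \<delta>) V (borel \<Otimes>\<^sub>M borel) R"
    using has_law_pairD(3)[OF \<open>prob_space M\<close> law(1,2) joint]
    by (simp add: indep_rv_def sets_Q measurable_cong_sets[OF refl sets_Q])
  then show ?thesis
    using joint has_law_pairD(1,2)[OF \<open>prob_space M\<close> law(1,2) joint] by (simp add: p)
qed

end
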